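(* For all $k,h,\delta,\beta>0$ the problem of finding $(u_h,\boldsymbol{\sigma}_h)\in V_h\times\boldsymbol{\Sigma}_h$ such that $$B_h(u_h,\boldsymbol{\sigma}_h;v_h,\boldsymbol{\tau}_h)=(f,v_h)_\Omega+\langle g,v_h\rangle_\Gamma\qquad\forall (v_h,\boldsymbol{\tau}_h)\in V_h\times\boldsymbol{\Sigma}_h$$ has a unique solution.
   Context: Let $\Omega\subset\mathbb{R}^d$ ($d=2,3$) be a bounded domain with boundary $\Gamma=\partial\Omega$ and outward unit normal $\mathbf{n}_\Omega$, strictly star-shaped with respect to a point $x_\Omega\in\Omega$, i.e. there is $c_\Omega>0$ with $(x-x_\Omega)\cdot\mathbf{n}_\Omega\ge c_\Omega$ for all $x\in\partial\Omega$. $\mathcal{T}_h$ is a family of partitions of $\Omega$ into triangles/tetrahedra, parameterized by the mesh size $h=\max_{K\in\mathcal{T}_h}\operatorname{diam}(K)>0$ and satisfying the minimal angle condition; $\mathcal{E}_h^I$ is the set of interior edges/faces. $k$ is the wave number, $\beta,\delta$ are penalty parameters, $f\in L^2(\Omega)$, $g\in L^2(\Gamma)$. All functions are complex-valued. $(u,v)_\Omega=\int_\Omega u\bar v\,dx$, $\langle u,v\rangle_e=\int_e u\bar v\,ds$, $\langle u,v\rangle_\Gamma=\int_\Gamma u\bar v\,ds$ (with dot products for vector functions); $\mathbf{i}=\sqrt{-1}$. $\nabla_h$ is the piecewise gradient, $\nabla_h|_K=\nabla|_K$ for $K\in\mathcal{T}_h$. On an interior edge/face $e$ shared by $K_1,K_2$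 with outward unit normals $\mathbf{n}_1,\mathbf{n}_2$: $\{v\}=\frac12(v_1+v_2)$ and $[[v]]=v_1\mathbf{n}_1+v_2\mathbf{n}_2$ for scalar $v$; $\{\mathbf{v}\}=\frac12(\mathbf{v}_1+\mathbf{v}_2)$ and $[[\mathbf{v}]]=\mathbf{v}_1\cdot\mathbf{n}_1+\mathbf{v}_2\cdot\mathbf{n}_2$ for vector $\mathbf{v}$. $V_h$ is the space of (discontinuous) functions in $L^2(\Omega)$ whose real and imaginary parts restricted to each $K\in\mathcal{T}_h$ are polynomials of degree $\le 1$; $\boldsymbol{\Sigma}_h$ is the space of vector fields in $(L^2(\Omega))^d$ whose real and imaginary parts restricted to each $K$ lie in $(P_1(K))^d$. The sesquilinear form (LDG method #2) is $$B_h(w_h,\boldsymbol{\chi}_h;v_h,\boldsymbol{\tau}_h)=(\boldsymbol{\chi}_h,\nabla_h v_h)_\Omega-k^2(w_h,v_h)_\Omega+\mathbf{i}k\langle w_h,v_h\rangle_\Gamma-\sum_{e\in\mathcal{E}_h^I}\langle\{\boldsymbol{\chi}_h\}-\mathbf{i}\beta[[w_h]],[[v_h]]\rangle_e$$ $$-\sum_{e\in\mathcal{E}_h^I}\Bigl(\mathbf{i}\delta\langle[[\boldsymbol{\chi}_h]],[[\boldsymbol{\tau}_h]]\rangle_e-\langle[[w_h]],\{\boldsymbol{\tau}_h\}\rangle_e\Bigr)+(\boldsymbol{\chi}_h,\boldsymbol{\tau}_h)_\Omega-(\nabla_h w_h,\boldsymbol{\tau}_h)_\Omega.$$ *)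

theory Defs
  imports "HOL-Analysis.Analysis"
begin

section \<open>Surface measure and outward normals\<close>

text \<open>The Lebesgue measure of dimension d - 1 on a hyperplane H, as a Borel measure on the ambient
  space: a subset of H is measured by the volume of the part of the slab of thickness 1 around H
  that lies orthogonally above and below it.\<close>

definition hyperplane_measure :: "'a::euclidean_space set \<Rightarrow> 'a measure" where
  "hyperplane_measure H =
     distr (restrict_space lborel {x. infdist x H \<le> 1/2}) borel (closest_point H)"

definition hyperplanes :: "'a::euclidean_space set set" where
  "hyperplanes = {H. affine H \<and> aff_dim H = int DIM('a) - 1}"

text \<open>Surface measure on a set A that is contained in finitely many hyperplanes (a face of an
  element, or the boundary of a polyhedral domain), concentrated on A.  Two distinct hyperplanes
  meet in a null set of either one, so summing the parts of A in the individual hyperplanes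
  counts nothing twice.\<close>

definition surface_measure :: "'a::euclidean_space set \<Rightarrow> 'a measure" where
  "surface_measure A = completion (measure_of UNIV (sets borel)
     (\<lambda>B. \<integral>\<^sup>+H. emeasure (hyperplane_measure H) (A \<inter> H \<inter> B) \<partial>count_space hyperplanes))"

lemma sets_hyperplane_measure [simp]: "sets (hyperplane_measure H) = sets borel"
  by (simp add: hyperplane_measure_def)

lemma emeasure_surface_measure:
  assumes A: "A \<in> sets borel" and B: "B \<in> sets borel"
  shows "emeasure (surface_measure A) B =
    (\<integral>\<^sup>+H. emeasure (hyperplane_measure H) (A \<inter> H \<inter> B) \<partial>count_space hyperplanes)"
proof -
  let ?f = "\<lambda>B. \<integral>\<^sup>+H. emeasure (hyperplane_measure H) (A \<inter> H \<inter> B) \<partial>count_space hyperplanes"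
  let ?M = "measure_of UNIV (sets borel) ?f"
  have H: "H \<in> sets borel" if "H \<in> hyperplanes" for H :: "'a set"
    using that unfolding hyperplanes_def by (blast intro: borel_closed affine_closed)
  have ca: "countably_additive (sets borel) ?f"
  proof (rule countably_additiveI)
    fix X :: "nat \<Rightarrow> 'a set"
    assume X: "range X \<subseteq> sets borel" "disjoint_family X" "(\<Union>i. X i) \<in> sets borel"
    have "(\<Sum>i. ?f (X i)) =
        (\<integral>\<^sup>+H. (\<Sum>i. emeasure (hyperplane_measure H) (A \<inter> H \<inter> X i)) \<partial>count_space hyperplanes)"
      by (rule nn_integral_suminf [symmetric]) (rule borel_measurable_count_space)
    also have "\<dots> = ?f (\<Union>i. X i)"
    proof (rule nn_integral_cong)
      fix H assume "H \<in> space (count_space (hyperplanes :: 'a set set))"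
      then have "H \<in> sets borel" using H by simp
      then have "range (\<lambda>i. A \<inter> H \<inter> X i) \<subseteq> sets (hyperplane_measure H)"
        using A X(1) unfolding sets_hyperplane_measure image_subset_iff by (blast intro: sets.Int)
      moreover have "disjoint_family (\<lambda>i. A \<inter> H \<inter> X i)"
        using X(2) unfolding disjoint_family_on_def by blast
      ultimately have "(\<Sum>i. emeasure (hyperplane_measure H) (A \<inter> H \<inter> X i)) =
          emeasure (hyperplane_measure H) (\<Union>i. A \<inter> H \<inter> X i)"
        by (rule suminf_emeasure)
      then show "(\<Sum>i. emeasure (hyperplane_measure H) (A \<inter> H \<inter> X i)) =
          emeasure (hyperplane_measure H) (A \<inter> H \<inter> (\<Union>i. X i))"
        by (simp only: Int_UN_distrib)
    qed
    finally show "(\<Sum>i. ?f (X i)) = ?f (\<Union>i. X i)" .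
  qed
  have "sigma_algebra UNIV (sets (borel :: 'a measure))"
    by (metis sets.sigma_algebra_axioms space_borel)
  then have sM: "sets ?M = sets borel" and "measure_space UNIV (sets borel) ?f"
    using ca by (auto simp only: sigma_algebra.sets_measure_of_eq measure_space_def positive_def
        Int_empty_right emeasure_empty nn_integral_const mult_zero_left)
  then have "emeasure ?M B = ?f B"
    using B ca by (intro emeasure_measure_of_sigma)
      (auto simp only: measure_space_def)
  moreover have BM: "B \<in> sets ?M"
    unfolding sM by (rule B)
  ultimately show ?thesis
    unfolding surface_measure_def
      emeasure_completion [OF sets_completionI_sets [OF BM]] main_part [OF BM] by blast
qed

text \<open>The boundary of S has outward unit normal n at x: up to arbitrarily thin cones around the
  tangent plane, S is locally the half space opposite to n.  On a polyhedral boundary this holds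
  exactly at the points in the relative interior of a flat piece, hence almost everywhere.\<close>

definition outward_unit_normal :: "'a::euclidean_space set \<Rightarrow> 'a \<Rightarrow> 'a \<Rightarrow> bool" where
  "outward_unit_normal S x n \<longleftrightarrow> x \<in> frontier S \<and> norm n = 1 \<and>
     (\<forall>\<epsilon>>0. \<exists>r>0. \<forall>y\<in>ball x r.
        ((y - x) \<bullet> n < - \<epsilon> * norm (y - x) \<longrightarrow> y \<in> S) \<and>
        ((y - x) \<bullet> n > \<epsilon> * norm (y - x) \<longrightarrow> y \<notin> S))"

definition outward_normal :: "'a::euclidean_space set \<Rightarrow> 'a \<Rightarrow> 'a" where
  "outward_normal S x = (THE n. outward_unit_normal S x n)"

text \<open>The normal of a polyhedral domain exists only off the edges and corners, so the condition
  is imposed at almost every boundary point; it includes the existence of the normal there.\<close>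

definition strictly_star_shaped :: "'a::euclidean_space set \<Rightarrow> 'a \<Rightarrow> bool" where
  "strictly_star_shaped \<Omega> x\<^sub>0 \<longleftrightarrow>
     (\<exists>c>0. AE x in surface_measure (frontier \<Omega>).
        \<exists>n. outward_unit_normal \<Omega> x n \<and> (x - x\<^sub>0) \<bullet> n \<ge> c)"

section \<open>Meshes\<close>

definition mesh_partition :: "'a::euclidean_space set \<Rightarrow> 'a set set \<Rightarrow> bool" where
  "mesh_partition \<Omega> T \<longleftrightarrow>
     finite T \<and> (\<forall>K\<in>T. int DIM('a) simplex K \<and> interior K \<subseteq> \<Omega>) \<and>
     (\<forall>K\<in>T. \<forall>K'\<in>T. K \<noteq> K' \<longrightarrow> interior K \<inter> interior K' = {}) \<and>
     \<Union>T = closure \<Omega>"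

definition mesh_size :: "'a::euclidean_space set set \<Rightarrow> real" where
  "mesh_size T = Max (diameter ` T)"

definition vector_angle :: "'a::real_inner \<Rightarrow> 'a \<Rightarrow> real" where
  "vector_angle a b = arccos (a \<bullet> b / (norm a * norm b))"

text \<open>All plane angles at the vertices and all dihedral angles of K are at least \<open>\<theta>\<close>
  (for triangles the two kinds of angles coincide).\<close>

definition angles_at_least :: "real \<Rightarrow> 'a::euclidean_space set \<Rightarrow> bool" where
  "angles_at_least \<theta> K \<longleftrightarrow>
     (\<forall>a b c. a extreme_point_of K \<and> b extreme_point_of K \<and> c extreme_point_of K \<and>
        a \<noteq> b \<and> a \<noteq> c \<and> b \<noteq> c \<longrightarrow> \<theta> \<le> vector_angle (b - a) (c - a)) \<and>
     (\<forall>F G. F facet_of K \<and> G facet_of K \<and> F \<noteq> G \<longrightarrow>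
        (\<forall>x\<in>rel_interior F. \<forall>y\<in>rel_interior G.
           \<theta> \<le> pi - vector_angle (outward_normal K x) (outward_normal K y)))"

text \<open>A family of partitions \<open>T h\<close>, indexed by their mesh sizes \<open>h \<in> I\<close>, with the minimal angle
  condition uniformly over the family.\<close>

definition mesh_family :: "'a::euclidean_space set \<Rightarrow> real set \<Rightarrow> (real \<Rightarrow> 'a set set) \<Rightarrow> bool" where
  "mesh_family \<Omega> I T \<longleftrightarrow>
     (\<forall>h\<in>I. h > 0 \<and> mesh_partition \<Omega> (T h) \<and> h = mesh_size (T h)) \<and>
     (\<exists>\<theta>>0. \<forall>h\<in>I. \<forall>K\<in>T h. angles_at_least \<theta> K)"

text \<open>Each interior edge/face is the common part of exactly two elements.\<close>

definition interior_faces :: "'a::euclidean_space set set \<Rightarrow> 'a set set" where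
  "interior_faces T =
     {K \<inter> K' | K K'. K \<in> T \<and> K' \<in> T \<and> K \<noteq> K' \<and> aff_dim (K \<inter> K') = int DIM('a) - 1}"

section \<open>Discrete spaces\<close>

definition L2 :: "'a measure \<Rightarrow> ('a \<Rightarrow> complex) set" where
  "L2 M = {v \<in> borel_measurable M. integrable M (\<lambda>x. (cmod (v x))\<^sup>2)}"

definition P1 :: "('a::euclidean_space \<Rightarrow> real) set" where
  "P1 = {p. \<exists>a b. p = (\<lambda>x. a + b \<bullet> x)}"

definition P1c :: "('a::euclidean_space \<Rightarrow> complex) set" where
  "P1c = {p. (\<lambda>x. Re (p x)) \<in> P1 \<and> (\<lambda>x. Im (p x)) \<in> P1}"

text \<open>Elements of \<open>L2\<close>, and hence of the discrete spaces, are represented by functions; two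
  representatives that agree almost everywhere stand for the same element.\<close>

definition V_h :: "'a::euclidean_space set \<Rightarrow> 'a set set \<Rightarrow> ('a \<Rightarrow> complex) set" where
  "V_h \<Omega> T = {v \<in> L2 (lebesgue_on \<Omega>). \<forall>K\<in>T. \<exists>p\<in>P1c. AE x in lebesgue_on K. v x = p x}"

definition Sigma_h ::
    "(real^'d) set \<Rightarrow> (real^'d) set set \<Rightarrow> (real^'d \<Rightarrow> complex^'d) set" where
  "Sigma_h \<Omega> T = {\<tau>. \<forall>i. (\<lambda>x. \<tau> x $ i) \<in> V_h \<Omega> T}"

text \<open>The polynomial that v restricts to on K.  Being defined on all of K, it also provides
  the one-sided traces of v on the faces of K.\<close>

definition piece :: "('a::euclidean_space \<Rightarrow> complex) \<Rightarrow> 'a set \<Rightarrow> 'a \<Rightarrow> complex" where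
  "piece v K = (THE p. p \<in> P1c \<and> (AE x in lebesgue_on K. v x = p x))"

definition vpiece :: "(real^'d \<Rightarrow> complex^'d) \<Rightarrow> (real^'d) set \<Rightarrow> real^'d \<Rightarrow> complex^'d" where
  "vpiece \<tau> K x = (\<chi> i. piece (\<lambda>y. \<tau> y $ i) K x)"

definition grad :: "(real^'d \<Rightarrow> complex) \<Rightarrow> real^'d \<Rightarrow> complex^'d" where
  "grad p x = (\<chi> i. frechet_derivative p (at x) (axis i 1))"

definition broken_grad ::
    "(real^'d) set set \<Rightarrow> (real^'d \<Rightarrow> complex) \<Rightarrow> real^'d \<Rightarrow> complex^'d" where
  "broken_grad T v x = (\<Sum>K\<in>{K\<in>T. x \<in> interior K}. grad (piece v K) x)"

text \<open>Almost every point of the boundary lies in a single element, so the sum has one term.\<close>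

definition boundary_trace ::
    "'a::euclidean_space set set \<Rightarrow> ('a \<Rightarrow> complex) \<Rightarrow> 'a \<Rightarrow> complex" where
  "boundary_trace T v x = (\<Sum>K\<in>{K\<in>T. x \<in> K}. piece v K x)"

text \<open>Averages and jumps on an interior edge/face e; the sums range over the two elements that
  share e.\<close>

definition avg :: "'a::euclidean_space set set \<Rightarrow> ('a \<Rightarrow> complex) \<Rightarrow> 'a set \<Rightarrow> 'a \<Rightarrow> complex" where
  "avg T v e x = 1/2 * (\<Sum>K\<in>{K\<in>T. e \<subseteq> K}. piece v K x)"

definition vavg ::
    "(real^'d) set set \<Rightarrow> (real^'d \<Rightarrow> complex^'d) \<Rightarrow> (real^'d) set \<Rightarrow> real^'d \<Rightarrow> complex^'d" where
  "vavg T \<tau> e x = (1/2) *\<^sub>R (\<Sum>K\<in>{K\<in>T. e \<subseteq> K}. vpiece \<tau> K x)"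

definition jump ::
    "(real^'d) set set \<Rightarrow> (real^'d \<Rightarrow> complex) \<Rightarrow> (real^'d) set \<Rightarrow> real^'d \<Rightarrow> complex^'d" where
  "jump T v e x =
     (\<Sum>K\<in>{K\<in>T. e \<subseteq> K}. \<chi> i. piece v K x * of_real (outward_normal K x $ i))"

definition vjump ::
    "(real^'d) set set \<Rightarrow> (real^'d \<Rightarrow> complex^'d) \<Rightarrow> (real^'d) set \<Rightarrow> real^'d \<Rightarrow> complex" where
  "vjump T \<tau> e x =
     (\<Sum>K\<in>{K\<in>T. e \<subseteq> K}. \<Sum>i\<in>UNIV. vpiece \<tau> K x $ i * of_real (outward_normal K x $ i))"

section \<open>The LDG form\<close>

definition ip :: "'a measure \<Rightarrow> ('a \<Rightarrow> complex) \<Rightarrow> ('a \<Rightarrow> complex) \<Rightarrow> complex" where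
  "ip M u v = (LINT x|M. u x * cnj (v x))"

definition vip :: "'a measure \<Rightarrow> ('a \<Rightarrow> complex^'d) \<Rightarrow> ('a \<Rightarrow> complex^'d) \<Rightarrow> complex" where
  "vip M u v = (LINT x|M. (\<Sum>i\<in>UNIV. u x $ i * cnj (v x $ i)))"

definition B_h ::
    "(real^'d) set \<Rightarrow> (real^'d) set set \<Rightarrow> real \<Rightarrow> real \<Rightarrow> real \<Rightarrow>
     (real^'d \<Rightarrow> complex) \<Rightarrow> (real^'d \<Rightarrow> complex^'d) \<Rightarrow>
     (real^'d \<Rightarrow> complex) \<Rightarrow> (real^'d \<Rightarrow> complex^'d) \<Rightarrow> complex" where
  "B_h \<Omega> T k \<beta> \<delta> w \<chi>h v \<tau> =
     vip (lebesgue_on \<Omega>) \<chi>h (broken_grad T v)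
     - (of_real k)\<^sup>2 * ip (lebesgue_on \<Omega>) w v
     + \<i> * of_real k * ip (surface_measure (frontier \<Omega>)) (boundary_trace T w) (boundary_trace T v)
     - (\<Sum>e\<in>interior_faces T.
          vip (surface_measure e)
            (\<lambda>x. vavg T \<chi>h e x - (\<chi> i. \<i> * of_real \<beta> * jump T w e x $ i)) (jump T v e))
     - (\<Sum>e\<in>interior_faces T.
          \<i> * of_real \<delta> * ip (surface_measure e) (vjump T \<chi>h e) (vjump T \<tau> e)
          - vip (surface_measure e) (jump T w e) (vavg T \<tau> e))
     + vip (lebesgue_on \<Omega>) \<chi>h \<tau>
     - vip (lebesgue_on \<Omega>) (broken_grad T w) \<tau>"

definition LDG_solution ::
    "(real^'d) set \<Rightarrow> (real^'d) set set \<Rightarrow> real \<Rightarrow> real \<Rightarrow> real \<Rightarrow>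
     (real^'d \<Rightarrow> complex) \<Rightarrow> (real^'d \<Rightarrow> complex) \<Rightarrow>
     (real^'d \<Rightarrow> complex) \<Rightarrow> (real^'d \<Rightarrow> complex^'d) \<Rightarrow> bool" where
  "LDG_solution \<Omega> T k \<beta> \<delta> f g u \<sigma> \<longleftrightarrow>
     u \<in> V_h \<Omega> T \<and> \<sigma> \<in> Sigma_h \<Omega> T \<and>
     (\<forall>v\<in>V_h \<Omega> T. \<forall>\<tau>\<in>Sigma_h \<Omega> T.
        B_h \<Omega> T k \<beta> \<delta> u \<sigma> v \<tau> =
          ip (lebesgue_on \<Omega>) f v + ip (surface_measure (frontier \<Omega>)) g (boundary_trace T v))"

end

theory Submission
  imports Defs
begin

text \<open>Up to functions that vanish almost everywhere the discrete spaces are finite-dimensional, trial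
  and test spaces coincide, and the form is sesquilinear.  The discrete problem is therefore a square
  linear system: it is uniquely solvable for every right-hand side as soon as the homogeneous problem
  has only the zero solution (\<open>kernel_trivial\<close>).

  Let \<open>(w, \<zeta>)\<close> solve the homogeneous problem.  Testing with \<open>(w, 0)\<close> and with \<open>(0, \<zeta>)\<close> and subtracting,
  the mixed volume terms add up to a number plus its conjugate, and so do the mixed face terms; the
  imaginary part of the difference is thus \<open>k\<close> times the squared norm of \<open>w\<close> on the boundary plus \<open>\<beta>\<close> and
  \<open>\<delta>\<close> times the squared norms of the jumps of \<open>w\<close> and \<open>\<zeta>\<close>.  Since the three parameters are positive, the boundary
  trace of \<open>w\<close> and all jumps vanish (\<open>kernel_traces_vanish\<close>).  What is left of the equation for test functions
  \<open>(0, \<tau>)\<close> says that \<open>\<zeta>\<close> is the piecewise gradient of \<open>w\<close> (\<open>kernel_flux\<close>).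

  Hence the affine pieces of \<open>w\<close> on two elements with a common face agree on that face and have gradients
  with the same normal component, so that they are the same affine function
  (\<open>pieces_agree_across_face\<close>).  Follow a generic ray from a generic point of an element until it leaves
  the domain: it crosses from element to element only through faces, so the piece from which it
  started is also the piece at the exit point, where the boundary condition makes it zero.  But
  after multiplication by a constant a piece that is nonzero at the starting point has a positive real part
  there, and this affine function does not decrease along a suitably chosen direction.  Hence all
  pieces are zero (\<open>matching_pieces_vanish\<close>).

  Genericity is what links the ray argument to conditions that hold only almost everywhere on the
  boundary: the points from which a line in a fixed direction meets a null set of the surface measure, or a
  polyhedron of codimension at least two, form a Lebesgue null set (\<open>negligible_shadow\<close>,
  \<open>negligible_shadow_low_dim\<close>).\<close>

section \<open>Finite linear systems\<close>

text \<open>Gaussian elimination: an equation with a nonzero coefficient is solved for the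
  corresponding unknown, which leaves one equation and one unknown fewer.\<close>

lemma underdetermined_system_nontrivial:
  fixes A :: "'i \<Rightarrow> 'j \<Rightarrow> 'a::field"
  assumes "finite I" "finite J" "card I < card J"
  shows "\<exists>x. (\<exists>j\<in>J. x j \<noteq> 0) \<and> (\<forall>i\<in>I. (\<Sum>j\<in>J. A i j * x j) = 0)"
  using assms
proof (induction I arbitrary: J A rule: finite_induct)
  case empty
  then obtain j where "j \<in> J" by fastforce
  then show ?case by (intro exI [of _ "\<lambda>_. 1"]) auto
next
  case (insert i0 I)
  show ?case
  proof (cases "\<forall>j\<in>J. A i0 j = 0")
    case True
    have "card I < card J" using insert.prems insert.hyps by simp
    then obtain x where x: "\<exists>j\<in>J. x j \<noteq> 0" "\<forall>i\<in>I. (\<Sum>j\<in>J. A i j * x j) = 0"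
      using insert.IH [of J A] insert.prems by blast
    have "(\<Sum>j\<in>J. A i0 j * x j) = 0" using True by (intro sum.neutral) simp
    with x show ?thesis by blast
  next
    case False
    then obtain j0 where j0: "j0 \<in> J" "A i0 j0 \<noteq> 0" by blast
    let ?J = "J - {j0}"
    have J: "finite ?J" "card I < card ?J"
      using insert.prems insert.hyps j0 by auto
    obtain x where x: "\<exists>j\<in>?J. x j \<noteq> 0"
      "\<forall>i\<in>I. (\<Sum>j\<in>?J. (A i j - A i j0 * A i0 j / A i0 j0) * x j) = 0"
      using insert.IH [OF J, of "\<lambda>i j. A i j - A i j0 * A i0 j / A i0 j0"] by blast
    define y where "y = x(j0 := - (\<Sum>j\<in>?J. A i0 j * x j) / A i0 j0)"
    have split: "(\<Sum>j\<in>J. A i j * y j) =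
        A i j0 * (- (\<Sum>j\<in>?J. A i0 j * x j) / A i0 j0) + (\<Sum>j\<in>?J. A i j * x j)" for i
    proof -
      have "(\<Sum>j\<in>J. A i j * y j) = A i j0 * y j0 + (\<Sum>j\<in>?J. A i j * y j)"
        using insert.prems j0 by (simp add: sum.remove)
      also have "(\<Sum>j\<in>?J. A i j * y j) = (\<Sum>j\<in>?J. A i j * x j)"
        by (intro sum.cong) (auto simp: y_def)
      finally show ?thesis by (simp add: y_def)
    qed
    have "(\<Sum>j\<in>J. A i j * y j) = 0" if "i \<in> insert i0 I" for i
    proof (cases "i = i0")
      case True
      show ?thesis unfolding split True using j0 by simp
    next
      case False
      then have "0 = (\<Sum>j\<in>?J. (A i j - A i j0 * A i0 j / A i0 j0) * x j)"
        using x(2) that by simp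
      also have "\<dots> = (\<Sum>j\<in>?J. A i j * x j) - A i j0 / A i0 j0 * (\<Sum>j\<in>?J. A i0 j * x j)"
        by (simp add: left_diff_distrib sum_subtractf sum_distrib_left mult.assoc)
      finally show ?thesis unfolding split by simp
    qed
    moreover have "\<exists>j\<in>J. y j \<noteq> 0" using x(1) by (auto simp: y_def)
    ultimately show ?thesis by blast
  qed
qed

text \<open>With the right-hand side as an additional column, the system has one unknown more than
  equations. In a nontrivial solution the coefficient of that column cannot be zero, by
  injectivity, and dividing by it solves the original system.\<close>

lemma injective_square_system_solvable:
  fixes A :: "'j \<Rightarrow> 'j \<Rightarrow> 'a::field"
  assumes J: "finite J"
    and inj: "\<And>x. \<forall>i\<in>J. (\<Sum>j\<in>J. A i j * x j) = 0 \<Longrightarrow> \<forall>j\<in>J. x j = 0"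
  shows "\<exists>x. \<forall>i\<in>J. (\<Sum>j\<in>J. A i j * x j) = b i"
proof -
  let ?J = "insert None (Some ` J)"
  let ?A = "\<lambda>i j. case j of None \<Rightarrow> - b i | Some j \<Rightarrow> A i j"
  have "card J < card ?J" using J by (simp add: card_image)
  then obtain x where x: "\<exists>j\<in>?J. x j \<noteq> 0" "\<forall>i\<in>J. (\<Sum>j\<in>?J. ?A i j * x j) = 0"
    using underdetermined_system_nontrivial [of J ?J ?A] J by blast
  have eq: "(\<Sum>j\<in>J. A i j * x (Some j)) = b i * x None" if "i \<in> J" for i
    using x(2) that J by (auto simp: sum.reindex)
  have s: "x None \<noteq> 0"
  proof
    assume "x None = 0"
    with eq inj [of "\<lambda>j. x (Some j)"] x(1) show False by auto
  qed
  have "(\<Sum>j\<in>J. A i j * (x (Some j) / x None)) = b i" if "i \<in> J" for i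
    using eq [OF that] s by (simp flip: sum_divide_distrib)
  then show ?thesis by (intro exI [of _ "\<lambda>j. x (Some j) / x None"] ballI)
qed

text \<open>The coordinates are functions on a whole type of which only the values on the finite
  set \<open>J\<close> matter; this lets \<open>J\<close> be a set of degrees of freedom that
  depends on a mesh.\<close>

lemma finite_dim_galerkin_solvable:
  fixes B :: "('j \<Rightarrow> complex) \<Rightarrow> ('j \<Rightarrow> complex) \<Rightarrow> complex"
  assumes J: "finite J"
    and left: "\<And>x y z a. B (\<lambda>j. x j + a * y j) z = B x z + a * B y z"
    and right: "\<And>x y z a. B z (\<lambda>j. x j + a * y j) = B z x + cnj a * B z y"
    and F: "\<And>x y a. F (\<lambda>j. x j + a * y j) = F x + cnj a * F y"
    and B0: "\<And>x z. \<forall>j\<in>J. x j = 0 \<Longrightarrow> B x z = 0" "\<And>x z. \<forall>j\<in>J. x j = 0 \<Longrightarrow> B z x = 0"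
    and F0: "\<And>x. \<forall>j\<in>J. x j = 0 \<Longrightarrow> F x = 0"
    and inj: "\<And>x. \<forall>z. B x z = 0 \<Longrightarrow> \<forall>j\<in>J. x j = 0"
  shows "\<exists>x. \<forall>z. B x z = F z"
proof -
  define \<delta> :: "'j \<Rightarrow> 'j \<Rightarrow> complex" where "\<delta> i = (\<lambda>j. if j = i then 1 else 0)" for i
  \<comment> \<open>Linear (\<open>s\<close> the identity) and antilinear (\<open>s\<close> the
    conjugation) functionals are expanded in unit vectors at the same time.\<close>
  have expand: "G x = (\<Sum>j\<in>J. s (x j) * G (\<delta> j))"
    if add: "\<And>x y a. G (\<lambda>j. x j + a * y j) = G x + s a * G y"
      and zero: "\<And>x. \<forall>j\<in>J. x j = 0 \<Longrightarrow> G x = 0"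
    for G :: "('j \<Rightarrow> complex) \<Rightarrow> complex" and s :: "complex \<Rightarrow> complex" and x
  proof -
    have *: "G (\<lambda>j. if j \<in> J' then x j else 0) = (\<Sum>j\<in>J'. s (x j) * G (\<delta> j))"
      if "J' \<subseteq> J" "finite J'" for J'
      using that(2,1)
    proof (induction J' rule: finite_induct)
      case empty
      then show ?case by (simp add: zero)
    next
      case (insert i J')
      have "(\<lambda>j. if j \<in> insert i J' then x j else 0) =
          (\<lambda>j. (if j \<in> J' then x j else 0) + x i * \<delta> i j)"
        using insert.hyps by (auto simp: \<delta>_def fun_eq_iff)
      then have "G (\<lambda>j. if j \<in> insert i J' then x j else 0) =
          G (\<lambda>j. if j \<in> J' then x j else 0) + s (x i) * G (\<delta> i)"
        by (simp only: add)
      with insert show ?case by (simp add: add.commute)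
    qed
    have "(\<lambda>j. x j + 1 * (if j \<in> J then 0 else - x j)) = (\<lambda>j. if j \<in> J then x j else 0)"
      by auto
    then have "G (\<lambda>j. if j \<in> J then x j else 0) = G x + s 1 * G (\<lambda>j. if j \<in> J then 0 else - x j)"
      using add [of x 1 "\<lambda>j. if j \<in> J then 0 else - x j"] by (simp only:)
    moreover have "G (\<lambda>j. if j \<in> J then 0 else - x j) = 0" by (rule zero) simp
    ultimately have "G x = G (\<lambda>j. if j \<in> J then x j else 0)" by (simp only: mult_zero_right add_0_right)
    then show ?thesis using * [OF order_refl J] by (rule trans)
  qed
  have B1: "B x z = (\<Sum>j\<in>J. x j * B (\<delta> j) z)" for x z
    by (rule expand [where s = "\<lambda>a. a" and G = "\<lambda>x. B x z"]) (fact left, erule B0(1))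
  have B2: "B z x = (\<Sum>j\<in>J. cnj (x j) * B z (\<delta> j))" for x z
    by (rule expand [where s = cnj and G = "B z"]) (fact right, erule B0(2))
  have F2: "F x = (\<Sum>j\<in>J. cnj (x j) * F (\<delta> j))" for x
    by (rule expand [where s = cnj and G = F]) (fact F, erule F0)
  have "\<exists>x. \<forall>i\<in>J. (\<Sum>j\<in>J. B (\<delta> j) (\<delta> i) * x j) = F (\<delta> i)"
  proof (rule injective_square_system_solvable [OF J])
    show "\<forall>j\<in>J. y j = 0" if "\<forall>i\<in>J. (\<Sum>j\<in>J. B (\<delta> j) (\<delta> i) * y j) = 0" for y
    proof (rule inj, rule allI)
      fix z
      have "B y (\<delta> i) = 0" if "i \<in> J" for i
        using \<open>\<forall>i\<in>J. _ = 0\<close> that unfolding B1 [of y "\<delta> i"] by (simp add: mult.commute)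
      then have "(\<Sum>j\<in>J. cnj (z j) * B y (\<delta> j)) = 0"
        by (intro sum.neutral ballI) simp
      then show "B y z = 0" using B2 [of y z] by argo
    qed
  qed
  then obtain x where x: "\<forall>i\<in>J. (\<Sum>j\<in>J. B (\<delta> j) (\<delta> i) * x j) = F (\<delta> i)" ..
  have "B x z = F z" for z
  proof -
    have "B x (\<delta> i) = F (\<delta> i)" if "i \<in> J" for i
      using x that unfolding B1 [of x "\<delta> i"] by (simp add: mult.commute)
    then have "(\<Sum>j\<in>J. cnj (z j) * B x (\<delta> j)) = (\<Sum>j\<in>J. cnj (z j) * F (\<delta> j))"
      by (intro sum.cong refl) simp
    then show ?thesis using B2 [of x z] F2 [of z] by argo
  qed
  then show ?thesis by blast
qed

section \<open>Square-integrable functions\<close>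

lemma L2_integrable_product:
  assumes "u \<in> L2 M" "v \<in> L2 M"
  shows "integrable M (\<lambda>x. u x * cnj (v x))"
proof (rule Bochner_Integration.integrable_bound)
  show "integrable M (\<lambda>x. (cmod (u x))\<^sup>2 + (cmod (v x))\<^sup>2)"
    using assms by (auto simp: L2_def)
  have "u \<in> borel_measurable M" "v \<in> borel_measurable M" using assms by (auto simp: L2_def)
  moreover have "cnj \<in> borel_measurable borel"
    by (intro borel_measurable_continuous_onI continuous_intros)
  ultimately show "(\<lambda>x. u x * cnj (v x)) \<in> borel_measurable M" by measurable
  have "a * b \<le> a\<^sup>2 + b\<^sup>2" if "a \<ge> 0" "b \<ge> 0" for a b :: real
    using sum_squares_bound [of a b] mult_nonneg_nonneg [OF that] by linarith
  then show "AE x in M. norm (u x * cnj (v x)) \<le> norm ((cmod (u x))\<^sup>2 + (cmod (v x))\<^sup>2)"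
    by (simp add: norm_mult)
qed

text \<open>Additivity and homogeneity are treated together throughout, by means of combinations
  \<open>u + c v\<close>.\<close>

lemma L2_comb:
  assumes "u \<in> L2 M" "v \<in> L2 M"
  shows "(\<lambda>x. u x + c * v x) \<in> L2 M"
proof -
  have m: "u \<in> borel_measurable M" "v \<in> borel_measurable M" using assms by (auto simp: L2_def)
  then have m': "(\<lambda>x. u x + c * v x) \<in> borel_measurable M" by simp
  have "integrable M (\<lambda>x. (cmod (u x + c * v x))\<^sup>2)"
  proof (rule Bochner_Integration.integrable_bound)
    show "integrable M (\<lambda>x. 2 * (cmod (u x))\<^sup>2 + 2 * (cmod c)\<^sup>2 * (cmod (v x))\<^sup>2)"
      using assms by (auto simp: L2_def)
    show "(\<lambda>x. (cmod (u x + c * v x))\<^sup>2) \<in> borel_measurable M" using m by simp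
    have "(cmod (a + c * b))\<^sup>2 \<le> 2 * (cmod a)\<^sup>2 + 2 * (cmod c)\<^sup>2 * (cmod b)\<^sup>2" for a b
    proof -
      have "(cmod (a + c * b))\<^sup>2 \<le> (cmod a + cmod (c * b))\<^sup>2"
        by (intro power_mono norm_triangle_ineq) simp
      also have "\<dots> \<le> 2 * (cmod a)\<^sup>2 + 2 * (cmod (c * b))\<^sup>2"
        using sum_squares_bound [of "cmod a" "cmod (c * b)"] by (simp add: power2_sum)
      finally show ?thesis by (simp add: norm_mult power_mult_distrib)
    qed
    then show "AE x in M. norm ((cmod (u x + c * v x))\<^sup>2) \<le>
        norm (2 * (cmod (u x))\<^sup>2 + 2 * (cmod c)\<^sup>2 * (cmod (v x))\<^sup>2)"
      by simp
  qed
  with m' show ?thesis by (simp add: L2_def)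
qed

lemma L2_zero [simp]: "(\<lambda>x. 0) \<in> L2 M"
  by (simp add: L2_def)

lemma L2_scale: "v \<in> L2 M \<Longrightarrow> (\<lambda>x. c * v x) \<in> L2 M"
  using L2_comb [of "\<lambda>x. 0" M v c] by simp

lemma L2_sum:
  assumes "finite S" "\<And>i. i \<in> S \<Longrightarrow> u i \<in> L2 M"
  shows "(\<lambda>x. \<Sum>i\<in>S. u i x) \<in> L2 M"
  using assms
proof (induction S rule: finite_induct)
  case (insert i S)
  then show ?case using L2_comb [of "u i" M "\<lambda>x. \<Sum>i\<in>S. u i x" 1] by simp
qed simp

lemma L2_bounded:
  assumes "finite_measure M" "f \<in> borel_measurable M" "AE x in M. cmod (f x) \<le> C"
  shows "f \<in> L2 M"
proof -
  interpret finite_measure M by fact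
  have "AE x in M. norm ((cmod (f x))\<^sup>2) \<le> C\<^sup>2"
    using assms(3) by eventually_elim (simp add: power_mono)
  then have "integrable M (\<lambda>x. (cmod (f x))\<^sup>2)"
    using assms(2) by (intro integrable_const_bound) auto
  with assms(2) show ?thesis by (simp add: L2_def)
qed

lemma ip_comb_left:
  assumes "u \<in> L2 M" "v \<in> L2 M" "w \<in> L2 M"
  shows "ip M (\<lambda>x. u x + c * v x) w = ip M u w + c * ip M v w"
  using L2_integrable_product [OF assms(1,3)] L2_integrable_product [OF assms(2,3)]
  by (simp add: ip_def distrib_right mult.assoc)

lemma ip_commute: "ip M v u = cnj (ip M u v)"
  by (simp add: ip_def mult.commute flip: Bochner_Integration.integral_cnj)

lemma ip_comb_right:
  assumes "u \<in> L2 M" "v \<in> L2 M" "w \<in> L2 M"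
  shows "ip M w (\<lambda>x. u x + c * v x) = ip M w u + cnj c * ip M w v"
  using ip_comb_left [OF assms, of c]
  by (simp add: ip_commute [of M w])

lemma ip_AE_0:
  assumes "AE x in M. u x = 0"
  shows "ip M u v = 0" "ip M v u = 0"
proof -
  have "AE x in M. u x * cnj (v x) = 0" using assms by eventually_elim simp
  then show "ip M u v = 0" unfolding ip_def by (rule integral_eq_zero_AE)
  then show "ip M v u = 0" by (simp add: ip_commute [of M v])
qed

lemma ip_self: "ip M u u = of_real (LINT x|M. (cmod (u x))\<^sup>2)"
  by (simp only: ip_def complex_norm_square [symmetric] integral_complex_of_real)

lemma ip_self_nonneg: "Re (ip M u u) \<ge> 0"
  by (simp add: ip_self)

lemma ip_self_0:
  assumes "u \<in> L2 M" "Re (ip M u u) = 0"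
  shows "AE x in M. u x = 0"
proof -
  have "integral\<^sup>L M (\<lambda>x. (cmod (u x))\<^sup>2) = 0" using assms(2) by (simp add: ip_self)
  then have "AE x in M. (cmod (u x))\<^sup>2 = 0"
    using assms(1) integral_nonneg_eq_0_iff_AE [of M "\<lambda>x. (cmod (u x))\<^sup>2"]
    by (simp add: L2_def)
  then show ?thesis by simp
qed

definition L2v :: "'a measure \<Rightarrow> ('a \<Rightarrow> complex^'d) set" where
  "L2v M = {u. \<forall>i. (\<lambda>x. u x $ i) \<in> L2 M}"

lemma L2v_comb: "u \<in> L2v M \<Longrightarrow> v \<in> L2v M \<Longrightarrow> (\<lambda>x. u x + c *s v x) \<in> L2v M"
  by (simp add: L2v_def L2_comb)

lemma vip_eq_sum:
  assumes "u \<in> L2v M" "v \<in> L2v M"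
  shows "vip M u v = (\<Sum>i\<in>UNIV. ip M (\<lambda>x. u x $ i) (\<lambda>x. v x $ i))"
  unfolding vip_def ip_def
  using assms by (intro Bochner_Integration.integral_sum L2_integrable_product) (auto simp: L2v_def)

lemma vip_comb_left:
  assumes "u \<in> L2v M" "v \<in> L2v M" "w \<in> L2v M"
  shows "vip M (\<lambda>x. u x + c *s v x) w = vip M u w + c * vip M v w"
proof -
  have "vip M (\<lambda>x. u x + c *s v x) w =
      (\<Sum>i\<in>UNIV. ip M (\<lambda>x. u x $ i + c * v x $ i) (\<lambda>x. w x $ i))"
    using vip_eq_sum [OF L2v_comb [OF assms(1,2)] assms(3)] by simp
  also have "\<dots> = (\<Sum>i\<in>UNIV. ip M (\<lambda>x. u x $ i) (\<lambda>x. w x $ i) + c * ip M (\<lambda>x. v x $ i) (\<lambda>x. w x $ i))"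
    using assms by (intro sum.cong ip_comb_left) (auto simp: L2v_def)
  finally show ?thesis using assms by (simp add: vip_eq_sum sum.distrib sum_distrib_left)
qed

lemma vip_commute: "vip M v u = cnj (vip M u v)"
  by (simp add: vip_def mult.commute flip: Bochner_Integration.integral_cnj)

lemma vip_comb_right:
  assumes "u \<in> L2v M" "v \<in> L2v M" "w \<in> L2v M"
  shows "vip M w (\<lambda>x. u x + c *s v x) = vip M w u + cnj c * vip M w v"
  using vip_comb_left [OF assms, of c]
  by (simp add: vip_commute [of M w])

lemma vip_AE_0:
  assumes "AE x in M. u x = 0"
  shows "vip M u v = 0" "vip M v u = 0"
proof -
  have "AE x in M. (\<Sum>i\<in>UNIV. u x $ i * cnj (v x $ i)) = 0" using assms by eventually_elim simp
  then show "vip M u v = 0" unfolding vip_def by (rule integral_eq_zero_AE)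
  then show "vip M v u = 0" by (simp add: vip_commute [of M v])
qed

lemma vip_self_nonneg: "Re (vip M u u) \<ge> 0"
  by (simp only: vip_def complex_norm_square [symmetric] of_real_sum [symmetric]
      integral_complex_of_real Re_complex_of_real)
    (auto intro!: Bochner_Integration.integral_nonneg sum_nonneg)

lemma vip_self_real: "Im (vip M u u) = 0"
  using vip_commute [of M u u] by (metis Im_complex_of_real Reals_cnj_iff complex_is_Real_iff)

lemma vip_self_0:
  assumes "u \<in> L2v M" "Re (vip M u u) = 0"
  shows "AE x in M. u x = 0"
proof -
  have "(\<Sum>i\<in>UNIV. Re (ip M (\<lambda>x. u x $ i) (\<lambda>x. u x $ i))) = 0"
    using assms by (simp add: vip_eq_sum)
  then have "Re (ip M (\<lambda>x. u x $ i) (\<lambda>x. u x $ i)) = 0" for i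
    by (subst (asm) sum_nonneg_eq_0_iff) (auto intro: ip_self_nonneg)
  then have "AE x in M. u x $ i = 0" for i
    using assms(1) by (intro ip_self_0) (auto simp: L2v_def)
  then have "AE x in M. \<forall>i. u x $ i = 0" by (intro AE_all_countable [THEN iffD2] allI)
  then show ?thesis by (simp add: vec_eq_iff)
qed

section \<open>Affine functions and their pieces\<close>

text \<open>The general form of the members of \<open>P1c\<close>, with value
  \<open>\<alpha>\<close> at the origin and gradient \<open>\<beta>\<close>.\<close>

definition affc :: "complex \<Rightarrow> complex^'d \<Rightarrow> real^'d \<Rightarrow> complex" where
  "affc \<alpha> \<beta> x = \<alpha> + (\<Sum>i\<in>UNIV. \<beta> $ i * of_real (x $ i))"

lemma Re_affc: "Re (affc \<alpha> \<beta> x) = Re \<alpha> + (\<chi> i. Re (\<beta> $ i)) \<bullet> x"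
  and Im_affc: "Im (affc \<alpha> \<beta> x) = Im \<alpha> + (\<chi> i. Im (\<beta> $ i)) \<bullet> x"
  by (simp_all add: affc_def inner_vec_def)

lemma P1c_eq_affc: "P1c = {p. \<exists>\<alpha> \<beta>. p = affc \<alpha> (\<beta> :: complex^'d)}"
proof (intro set_eqI iffI)
  fix p :: "real^'d \<Rightarrow> complex" assume "p \<in> P1c"
  then obtain a b a' b' where "(\<lambda>x. Re (p x)) = (\<lambda>x. a + b \<bullet> x)" "(\<lambda>x. Im (p x)) = (\<lambda>x. a' + b' \<bullet> x)"
    by (auto simp: P1c_def P1_def)
  then have "p = affc (Complex a a') (\<chi> i. Complex (b $ i) (b' $ i))"
    by (auto simp: fun_eq_iff complex_eq_iff Re_affc Im_affc)
  then show "p \<in> {p. \<exists>\<alpha> \<beta>. p = affc \<alpha> \<beta>}" by blast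
next
  fix p :: "real^'d \<Rightarrow> complex" assume "p \<in> {p. \<exists>\<alpha> \<beta>. p = affc \<alpha> \<beta>}"
  then obtain \<alpha> \<beta> where "p = affc \<alpha> \<beta>" by blast
  then show "p \<in> P1c" unfolding P1c_def P1_def by (auto simp: Re_affc Im_affc)
qed

lemma affc_in_P1c: "affc \<alpha> \<beta> \<in> P1c"
  by (auto simp: P1c_eq_affc)

lemma affc_comb: "affc \<alpha> \<beta> x + c * affc \<alpha>' \<beta>' x = affc (\<alpha> + c * \<alpha>') (\<beta> + c *s \<beta>') x"
  by (simp add: affc_def algebra_simps sum.distrib sum_distrib_left)

lemma P1c_comb:
  fixes p q :: "real^'d \<Rightarrow> complex"
  assumes "p \<in> P1c" "q \<in> P1c"
  shows "(\<lambda>x. p x + c * q x) \<in> P1c"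
proof -
  obtain \<alpha> \<beta> \<alpha>' \<beta>' where "p = affc \<alpha> \<beta>" "q = affc \<alpha>' \<beta>'"
    using assms by (auto simp: P1c_eq_affc)
  then have "(\<lambda>x. p x + c * q x) = affc (\<alpha> + c * \<alpha>') (\<beta> + c *s \<beta>')"
    by (simp add: affc_comb fun_eq_iff)
  then show ?thesis by (simp add: affc_in_P1c)
qed

lemma continuous_on_affc: "continuous_on S (affc \<alpha> \<beta>)"
  unfolding affc_def by (intro continuous_intros)

lemma continuous_on_P1c: "p \<in> P1c \<Longrightarrow> continuous_on S (p :: real^'d \<Rightarrow> complex)"
  by (auto simp: P1c_eq_affc continuous_on_affc)

lemma negligible_affc_zeros:
  assumes "\<alpha> \<noteq> 0 \<or> \<beta> \<noteq> 0"
  shows "negligible {x. affc \<alpha> \<beta> x = 0}"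
proof -
  have sub: "{x. affc \<alpha> \<beta> x = 0} \<subseteq> {x. (\<chi> i. Re (\<beta> $ i)) \<bullet> x = - Re \<alpha>}"
    "{x. affc \<alpha> \<beta> x = 0} \<subseteq> {x. (\<chi> i. Im (\<beta> $ i)) \<bullet> x = - Im \<alpha>}"
    by (auto simp: complex_eq_iff Re_affc Im_affc)
  have "((\<chi> i. Re (\<beta> $ i)) \<noteq> 0 \<or> Re \<alpha> \<noteq> 0) \<or> ((\<chi> i. Im (\<beta> $ i)) \<noteq> 0 \<or> Im \<alpha> \<noteq> 0)"
    using assms by (auto simp: vec_eq_iff complex_eq_iff)
  then show ?thesis
    by (metis negligible_hyperplane negligible_subset neg_equal_0_iff_equal sub)
qed

lemma affc_eq_0D:
  assumes "affc \<alpha> \<beta> = (\<lambda>x. 0)" shows "\<alpha> = 0" "\<beta> = 0"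
proof -
  have "{x. affc \<alpha> \<beta> x = 0} = UNIV" using assms by simp
  moreover have "\<not> negligible (UNIV :: (real^'d) set)" using open_not_negligible by blast
  ultimately show "\<alpha> = 0" "\<beta> = 0" using negligible_affc_zeros [of \<alpha> \<beta>] by auto
qed

text \<open>The zeros of a nonzero affine function lie in a hyperplane or are absent.\<close>

lemma P1c_eqI:
  fixes p q :: "real^'d \<Rightarrow> complex"
  assumes "p \<in> P1c" "q \<in> P1c" "\<not> negligible S" "negligible {x\<in>S. p x \<noteq> q x}"
  shows "p = q"
proof -
  obtain \<alpha> \<beta> \<alpha>' \<beta>' where pq: "p = affc \<alpha> \<beta>" "q = affc \<alpha>' \<beta>'"
    using assms by (auto simp: P1c_eq_affc)
  have diff: "affc (\<alpha> - \<alpha>') (\<beta> - \<beta>') x = p x - q x" for x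
    using affc_comb [of \<alpha> \<beta> x "-1" \<alpha>' \<beta>'] by (simp add: pq)
  show ?thesis
  proof (rule ccontr)
    assume "p \<noteq> q"
    then have "\<alpha> - \<alpha>' \<noteq> 0 \<or> \<beta> - \<beta>' \<noteq> 0" using pq by auto
    then have "negligible {x. p x - q x = 0}"
      using negligible_affc_zeros unfolding diff [symmetric] by blast
    then have "negligible ({x. p x - q x = 0} \<union> {x\<in>S. p x \<noteq> q x})"
      using assms(4) by (rule negligible_Un)
    then have "negligible S" by (rule negligible_subset) auto
    with assms(3) show False by contradiction
  qed
qed

lemma AE_lebesgue_on_iff:
  assumes "S \<in> sets lebesgue"
  shows "(AE x in lebesgue_on S. P x) \<longleftrightarrow> negligible {x\<in>S. \<not> P x}"
proof -
  have "(AE x in lebesgue_on S. P x) \<longleftrightarrow> (AE x in lebesgue. x \<in> S \<longrightarrow> P x)"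
    using assms by (simp add: AE_restrict_space_iff)
  also have "\<dots> \<longleftrightarrow> negligible {x\<in>S. \<not> P x}"
    by (simp add: completion.AE_iff_null_sets negligible_iff_null_sets)
  finally show ?thesis .
qed

lemma piece_eqI:
  fixes v :: "real^'d \<Rightarrow> complex"
  assumes "compact K" "interior K \<noteq> {}" "p \<in> P1c" "AE x in lebesgue_on K. v x = p x"
  shows "piece v K = p"
  unfolding piece_def
proof (rule the_equality)
  fix q assume q: "q \<in> P1c \<and> (AE x in lebesgue_on K. v x = q x)"
  have K: "K \<in> sets lebesgue" using assms(1) by (simp add: compact_imp_closed lmeasurable_compact fmeasurableD)
  have "AE x in lebesgue_on K. q x = p x" using assms(4) q by (auto elim: eventually_elim2)
  then have "negligible {x\<in>K. q x \<noteq> p x}" using AE_lebesgue_on_iff [OF K] by simp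
  moreover have "\<not> negligible K"
    using assms(2) negligible_subset [OF _ interior_subset] open_not_negligible [OF open_interior] by blast
  ultimately show "q = p"
    using q assms by (intro P1c_eqI [of q p "K"]) auto
qed (use assms in auto)

lemma grad_affc: "grad (affc \<alpha> \<beta>) x = \<beta>"
proof -
  have "(affc \<alpha> \<beta> has_derivative (\<lambda>h. \<Sum>i\<in>UNIV. \<beta> $ i * of_real (h $ i))) (at x)"
    unfolding affc_def
    by (auto intro!: derivative_eq_intros has_derivative_of_real bounded_linear_imp_has_derivative
        bounded_linear_vec_nth simp: fun_eq_iff)
  then have "frechet_derivative (affc \<alpha> \<beta>) (at x) = (\<lambda>h. \<Sum>i\<in>UNIV. \<beta> $ i * of_real (h $ i))"
    by (rule frechet_derivative_at [symmetric])
  then show ?thesis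
    by (simp add: grad_def vec_eq_iff axis_def if_distrib if_distribR cong: if_cong)
qed

lemma grad_P1c_comb:
  assumes "p \<in> P1c" "q \<in> P1c"
  shows "grad (\<lambda>x. p x + c * q x) x = grad p x + c *s grad q (x :: real^'d)"
proof -
  obtain \<alpha> \<beta> \<alpha>' \<beta>' where pq: "p = affc \<alpha> \<beta>" "q = affc \<alpha>' \<beta>'"
    using assms by (auto simp: P1c_eq_affc)
  then have "(\<lambda>x. p x + c * q x) = affc (\<alpha> + c * \<alpha>') (\<beta> + c *s \<beta>')"
    by (simp add: affc_comb fun_eq_iff)
  then show ?thesis by (simp add: pq grad_affc)
qed

lemma grad_component_P1c:
  assumes "p \<in> P1c" shows "(\<lambda>x::real^'d. grad p x $ i) \<in> P1c"
proof -
  obtain \<alpha> \<beta> where "p = affc \<alpha> \<beta>" using assms by (auto simp: P1c_eq_affc)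
  then have "(\<lambda>x. grad p x $ i) = (\<lambda>x. \<beta> $ i)" by (simp only: grad_affc)
  also have "\<dots> = affc (\<beta> $ i) 0" by (simp add: affc_def fun_eq_iff)
  finally show ?thesis by (simp only: affc_in_P1c)
qed

lemma P1c_bounded:
  assumes "p \<in> P1c" "bounded S"
  obtains C where "\<And>x. x \<in> S \<Longrightarrow> cmod (p (x :: real^'d)) \<le> C"
proof -
  have "compact (p ` closure S)"
    using assms by (intro compact_continuous_image continuous_on_P1c) (auto simp: compact_closure)
  then obtain C where "\<And>y. y \<in> p ` closure S \<Longrightarrow> norm y \<le> C"
    using compact_imp_bounded bounded_iff by metis
  with that closure_subset [of S] show thesis by blast
qed

lemma P1c_borel: "p \<in> P1c \<Longrightarrow> p \<in> borel_measurable (borel :: (real^'d) measure)"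
  by (intro borel_measurable_continuous_onI continuous_on_P1c)

lemma L2_indicator_P1c:
  fixes p :: "real^'d \<Rightarrow> complex"
  assumes M: "finite_measure M" "AE x in M. x \<in> B" and "bounded B"
    and meas: "\<And>f :: real^'d \<Rightarrow> complex. f \<in> borel_measurable borel \<Longrightarrow> f \<in> borel_measurable M"
    and p: "p \<in> P1c" and S: "S \<in> sets borel"
  shows "(\<lambda>x. indicator S x * p x) \<in> L2 M"
proof -
  obtain C where C: "\<And>x. x \<in> B \<Longrightarrow> cmod (p x) \<le> C" using P1c_bounded [OF p \<open>bounded B\<close>] by blast
  have "(\<lambda>x. indicator S x * p x) \<in> borel_measurable borel"
    using S P1c_borel [OF p] by (intro borel_measurable_times borel_measurable_indicator)
  then have "(\<lambda>x. indicator S x * p x) \<in> borel_measurable M" by (rule meas)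
  moreover have "AE x in M. cmod (indicator S x * p x) \<le> max C 0"
    using M(2) by eventually_elim (use C in \<open>auto simp: indicator_def le_max_iff_disj\<close>)
  ultimately show ?thesis using M(1) by (intro L2_bounded)
qed

section \<open>Surface measure\<close>

text \<open>The orthogonal projection onto the hyperplane \<open>n \<bullet> x = c\<close>,
  provided that \<open>n\<close> is a unit vector.\<close>

definition hproj :: "'a::euclidean_space \<Rightarrow> real \<Rightarrow> 'a \<Rightarrow> 'a" where
  "hproj n c x = x - (n \<bullet> x - c) *\<^sub>R n"

lemma inner_hproj: "norm n = 1 \<Longrightarrow> n \<bullet> hproj n c x = c"
  by (simp add: hproj_def inner_diff_right dot_square_norm)

lemma hproj_same: "n \<bullet> x = c \<Longrightarrow> hproj n c x = x"
  by (simp add: hproj_def)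

lemma hproj_shift: "norm n = 1 \<Longrightarrow> hproj n c (x + t *\<^sub>R n) = hproj n c x"
  by (simp add: hproj_def inner_add_right dot_square_norm algebra_simps)

lemma hproj_plus: "hproj n c x + (n \<bullet> x - c) *\<^sub>R n = x"
  by (simp add: hproj_def)

lemma continuous_on_hproj: "continuous_on S (hproj n c)"
  unfolding hproj_def by (intro continuous_intros)

lemma borel_measurable_hproj [measurable]: "hproj n c \<in> borel_measurable borel"
  by (intro borel_measurable_continuous_onI continuous_on_hproj)

lemma hyperplane_unit_normal:
  fixes H :: "'a::euclidean_space set"
  assumes "H \<in> hyperplanes"
  obtains n c where "norm n = 1" "H = {x. n \<bullet> x = c}"
proof -
  have "affine hull H = H" and "aff_dim H = int DIM('a) - 1"
    using assms by (simp_all add: hyperplanes_def)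
  then have "\<exists>a b. a \<noteq> 0 \<and> H = {x. a \<bullet> x = b}"
    using aff_dim_eq_hyperplane [of H] DIM_positive [where 'a = 'a]
    by (simp only: simp_thms of_nat_diff Suc_leI One_nat_def of_nat_Suc of_nat_0 add_0_left add_0_right)
  then obtain a b where ab: "a \<noteq> 0" "H = {x. a \<bullet> x = b}" by blast
  have "a \<bullet> x = b \<longleftrightarrow> (a /\<^sub>R norm a) \<bullet> x = b / norm a" for x
    using ab(1) by (simp add: field_simps)
  with ab show thesis by (intro that [of "a /\<^sub>R norm a" "b / norm a"]) auto
qed

lemma unit_hyperplane_in_hyperplanes: "norm n = 1 \<Longrightarrow> {x. n \<bullet> x = c} \<in> hyperplanes"
  unfolding hyperplanes_def using aff_dim_hyperplane [of n c]
  by (cases "n = 0") (auto simp: affine_hyperplane)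

lemma closest_point_hyperplane:
  fixes n :: "'a::euclidean_space"
  assumes "norm n = 1"
  shows "closest_point {x. n \<bullet> x = c} x = hproj n c x"
proof (rule closest_point_unique [symmetric])
  show "\<forall>z\<in>{x. n \<bullet> x = c}. dist x (hproj n c x) \<le> dist x z"
  proof
    fix z assume "z \<in> {x. n \<bullet> x = c}"
    then have "n \<bullet> x - c = n \<bullet> (x - z)" by (simp add: inner_diff_right)
    then have "\<bar>n \<bullet> x - c\<bar> \<le> norm (x - z)"
      using Cauchy_Schwarz_ineq2 [of n "x - z"] assms by simp
    then show "dist x (hproj n c x) \<le> dist x z"
      using assms by (simp add: hproj_def dist_norm)
  qed
qed (use assms in \<open>auto simp: convex_hyperplane closed_hyperplane inner_hproj\<close>)

lemma infdist_hyperplane: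
  fixes n :: "'a::euclidean_space"
  assumes "norm n = 1"
  shows "infdist x {x. n \<bullet> x = c} = \<bar>n \<bullet> x - c\<bar>"
proof -
  have "hproj n c x \<in> {x. n \<bullet> x = c}" using assms by (simp add: inner_hproj)
  then have "infdist x {x. n \<bullet> x = c} = dist x (closest_point {x. n \<bullet> x = c} x)"
    unfolding infdist_eq_setdist by (intro setdist_closest_point closed_hyperplane) auto
  also have "\<dots> = \<bar>n \<bullet> x - c\<bar>"
    using assms by (simp add: closest_point_hyperplane hproj_def dist_norm)
  finally show ?thesis .
qed

lemma emeasure_hyperplane_measure:
  fixes n :: "'a::euclidean_space"
  assumes n: "norm n = 1" and A: "A \<in> sets borel"
  shows "emeasure (hyperplane_measure {x. n \<bullet> x = c}) A =
    emeasure lborel {x. \<bar>n \<bullet> x - c\<bar> \<le> 1/2 \<and> hproj n c x \<in> A}"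
proof -
  let ?S = "{x. \<bar>n \<bullet> x - c\<bar> \<le> 1/2}"
  have "closed ?S" by (intro closed_Collect_le continuous_intros)
  then have S: "?S \<in> sets borel" by simp
  have m: "hproj n c \<in> measurable (restrict_space lborel ?S) borel"
    by (intro measurable_restrict_space1) simp
  have "emeasure (hyperplane_measure {x. n \<bullet> x = c}) A =
      emeasure (distr (restrict_space lborel ?S) borel (hproj n c)) A"
    by (simp only: hyperplane_measure_def infdist_hyperplane [OF n]
        ext [of "closest_point {x. n \<bullet> x = c}" "hproj n c", OF closest_point_hyperplane [OF n]])
  also have "\<dots> = emeasure (restrict_space lborel ?S) (hproj n c -` A \<inter> ?S)"
    using A m by (subst emeasure_distr) (auto simp: space_restrict_space)
  also have "\<dots> = emeasure lborel (hproj n c -` A \<inter> ?S)"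
    using S by (intro emeasure_restrict_space) auto
  finally show ?thesis by (simp add: vimage_def Collect_conj_eq Int_commute)
qed

lemma hyperplanes_borel: "H \<in> hyperplanes \<Longrightarrow> H \<in> sets borel"
  by (elim hyperplane_unit_normal) (auto intro: borel_closed closed_hyperplane)

text \<open>The projection onto \<open>H\<close> maps into \<open>G\<close> only the points that
  satisfy one further affine equation. This equation is nontrivial because the hyperplanes differ,
  so its solutions are a null set.\<close>

lemma hyperplane_measure_other_hyperplane:
  assumes H: "H \<in> hyperplanes" and G: "G \<in> hyperplanes" and ne: "G \<noteq> H"
    and A: "A \<in> sets borel" "A \<subseteq> G \<inter> H"
  shows "emeasure (hyperplane_measure H) A = 0"
proof -
  obtain n c where n: "norm n = 1" "H = {x. n \<bullet> x = c}" using H by (rule hyperplane_unit_normal)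
  obtain m d where m: "norm m = 1" "G = {x. m \<bullet> x = d}" using G by (rule hyperplane_unit_normal)
  let ?a = "m - (m \<bullet> n) *\<^sub>R n" and ?b = "d - (m \<bullet> n) * c"
  have eq: "m \<bullet> hproj n c x = d \<longleftrightarrow> ?a \<bullet> x = ?b" for x
    by (auto simp: hproj_def inner_diff_right inner_diff_left algebra_simps)
  have "?a \<noteq> 0 \<or> ?b \<noteq> 0"
  proof (rule ccontr)
    assume "\<not> (?a \<noteq> 0 \<or> ?b \<noteq> 0)"
    then have "m \<bullet> hproj n c x = d" for x using eq by simp
    then have "H \<subseteq> G" unfolding n(2) m(2) by (metis (mono_tags) Collect_mono hproj_same)
    moreover have "affine G" "affine H" "aff_dim G = aff_dim H" "H \<noteq> {}"
      using H G n inner_hproj [OF n(1), of c 0] by (auto simp: hyperplanes_def)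
    ultimately have "H = G" by (metis affine_dim_equal)
    with ne show False by simp
  qed
  then have "negligible {x. ?a \<bullet> x = ?b}" by (rule negligible_hyperplane)
  then have "negligible {x. \<bar>n \<bullet> x - c\<bar> \<le> 1/2 \<and> hproj n c x \<in> A}"
    by (rule negligible_subset) (use A m eq in auto)
  moreover have "{x. \<bar>n \<bullet> x - c\<bar> \<le> 1/2 \<and> hproj n c x \<in> A} \<in> sets lborel"
    using A by measurable
  ultimately show ?thesis
    using A(1) n by (simp add: emeasure_hyperplane_measure negligible_iff_null_sets null_sets_completion_iff)
      (auto simp: null_sets_def)
qed

lemma sets_surface_measure_borel: "A \<in> sets borel \<Longrightarrow> A \<in> sets (surface_measure B)"
  and space_surface_measure [simp]: "space (surface_measure B) = UNIV"
proof -
  show "A \<in> sets borel \<Longrightarrow> A \<in> sets (surface_measure B)"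
    unfolding surface_measure_def
    by (intro sets_completionI_sets) (simp add: sigma_algebra.sets_measure_of_eq
        sets.sigma_algebra_axioms [of borel, simplified])
  show "space (surface_measure B) = UNIV"
    by (simp add: surface_measure_def)
qed

lemma borel_measurable_surface_measure:
  "f \<in> borel_measurable borel \<Longrightarrow> f \<in> borel_measurable (surface_measure B)"
  by (auto simp: measurable_def sets_surface_measure_borel)

text \<open>Only the finitely many hyperplanes of the cover contribute to the defining sum, and
  each contributes the volume of a bounded slab.\<close>

lemma surface_measure_finite:
  assumes A: "A \<in> sets borel" "bounded A" and HS: "finite HS" "HS \<subseteq> hyperplanes" "A \<subseteq> \<Union>HS"
  shows "finite_measure (surface_measure A)"
proof
  have U: "(UNIV :: 'a set) \<in> sets borel" by simp
  let ?f = "\<lambda>H. emeasure (hyperplane_measure H) (A \<inter> H)"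
  \<comment> \<open>A hyperplane outside the cover meets \<open>A\<close> only within its
    intersections with the hyperplanes of the cover.\<close>
  have zero: "?f H = 0" if "H \<in> hyperplanes - HS" for H
  proof -
    have H: "H \<in> hyperplanes" "H \<notin> HS" using that by auto
    have AH: "A \<inter> H \<inter> G \<in> sets (hyperplane_measure H)" if "G \<in> HS" for G
      using A H HS that hyperplanes_borel by (auto intro!: sets.Int)
    have "?f H = emeasure (hyperplane_measure H) (\<Union>G\<in>HS. A \<inter> H \<inter> G)"
      using HS(3) by (intro arg_cong2 [where f = emeasure]) auto
    also have "\<dots> \<le> (\<Sum>G\<in>HS. emeasure (hyperplane_measure H) (A \<inter> H \<inter> G))"
      using AH HS(1) by (intro emeasure_subadditive_finite) auto
    also have "\<dots> = 0"
    proof (intro sum.neutral ballI)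
      fix G assume G: "G \<in> HS"
      have "G \<in> hyperplanes" "G \<noteq> H" using G H HS by auto
      with H AH [OF G] show "emeasure (hyperplane_measure H) (A \<inter> H \<inter> G) = 0"
        by (intro hyperplane_measure_other_hyperplane [of H G]) auto
    qed
    finally show ?thesis by simp
  qed
  have fin: "?f H < \<infinity>" if H: "H \<in> HS" for H
  proof -
    obtain n c where n: "norm n = 1" "H = {x. n \<bullet> x = c}"
      using H HS hyperplane_unit_normal by (metis subsetD)
    obtain r where r: "\<And>x. x \<in> A \<Longrightarrow> norm x \<le> r" using A(2) by (auto simp: bounded_iff)
    let ?S = "{x. \<bar>n \<bullet> x - c\<bar> \<le> 1/2 \<and> hproj n c x \<in> A \<inter> H}"
    have "?S \<subseteq> cball 0 (r + 1/2)"
    proof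
      fix x assume x: "x \<in> ?S"
      have "norm x \<le> norm (hproj n c x) + norm ((n \<bullet> x - c) *\<^sub>R n)"
        by (metis hproj_plus norm_triangle_ineq)
      with x r [of "hproj n c x"] n show "x \<in> cball 0 (r + 1/2)" by simp
    qed
    then have "emeasure lborel ?S \<le> emeasure lborel (cball 0 (r + 1/2) :: 'a set)"
      by (intro emeasure_mono) auto
    also have "\<dots> < \<infinity>" by (rule emeasure_lborel_cball_finite)
    finally show ?thesis
      using n A H HS hyperplanes_borel [of H] by (simp add: emeasure_hyperplane_measure)
  qed
  have "emeasure (surface_measure A) (space (surface_measure A)) =
      (\<integral>\<^sup>+H. ?f H \<partial>count_space hyperplanes)"
    using emeasure_surface_measure [OF A(1) U] by simp
  also have "\<dots> = (\<Sum>H\<in>HS. ?f H)"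
    using zero HS by (intro nn_integral_count_space') auto
  also have "\<dots> \<noteq> \<infinity>" using fin HS(1) by (simp add: less_top)
  finally show "emeasure (surface_measure A) (space (surface_measure A)) \<noteq> \<infinity>" .
qed

lemma AE_surface_measureE:
  fixes A :: "'a::euclidean_space set"
  assumes "AE x in surface_measure A. P x"
  obtains N where "N \<in> sets borel" "emeasure (surface_measure A) N = 0" "{x. \<not> P x} \<subseteq> N"
proof -
  have "AE x in measure_of UNIV (sets borel)
      (\<lambda>B. \<integral>\<^sup>+H. emeasure (hyperplane_measure H) (A \<inter> H \<inter> B) \<partial>count_space hyperplanes). P x"
    (is "AE x in ?M. _")
    using assms unfolding surface_measure_def AE_completion_iff .
  then obtain N where N: "N \<in> null_sets ?M" "{x. \<not> P x} \<subseteq> N"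
    by (auto simp: eventually_ae_filter)
  have "sets ?M = sets borel"
    using sets.sigma_sets_eq [of "borel :: 'a measure"] by (simp add: sets_measure_of_conv)
  with N have "N \<in> sets borel" by (auto simp: null_sets_def)
  moreover have "emeasure (surface_measure A) N = 0"
    using N null_sets_completionI [of N ?M] by (auto simp: surface_measure_def null_sets_def)
  ultimately show thesis using that N by blast
qed

text \<open>The form in which null sets of the surface measure are used: the union of the lines
  orthogonal to the hyperplane through such a set is a Lebesgue null set of the ambient
  space.\<close>

lemma AE_surface_measure_lines:
  fixes A :: "'a::euclidean_space set"
  assumes A: "A \<in> sets borel" and ae: "AE x in surface_measure A. P x" and n: "norm n = 1"
  shows "negligible {x. hproj n c x \<in> A \<and> \<not> P (hproj n c x)}"
proof -
  let ?H = "{x. n \<bullet> x = c}"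
  obtain N where N: "N \<in> sets borel" "emeasure (surface_measure A) N = 0" "{x. \<not> P x} \<subseteq> N"
    using ae by (rule AE_surface_measureE)
  have H: "?H \<in> hyperplanes" "?H \<in> sets borel"
    using n unit_hyperplane_in_hyperplanes hyperplanes_borel by blast+
  have "emeasure (hyperplane_measure ?H) (A \<inter> ?H \<inter> N) = 0"
    using N(2) H(1) emeasure_surface_measure [OF A N(1)]
    by (simp add: nn_integral_0_iff_AE AE_count_space)
  then have 0: "emeasure lborel {x. \<bar>n \<bullet> x - c\<bar> \<le> 1/2 \<and> hproj n c x \<in> A \<inter> ?H \<inter> N} = 0"
    using A H N by (simp add: emeasure_hyperplane_measure [OF n])
  define Z where "Z = {x. \<bar>n \<bullet> x - c\<bar> \<le> 1/2 \<and> hproj n c x \<in> A \<inter> ?H \<inter> N}"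
  have "A \<inter> ?H \<inter> N \<in> sets borel" using A H N by auto
  then have "Z \<in> sets lborel" unfolding Z_def by measurable
  with 0 have "Z \<in> null_sets lborel" by (auto simp: Z_def null_sets_def)
  then have Z: "negligible Z" by (simp add: negligible_iff_null_sets null_sets_completionI)
  have "{x. hproj n c x \<in> A \<and> \<not> P (hproj n c x)} \<subseteq> (\<Union>m::int. (+) (of_int m *\<^sub>R n) ` Z)"
  proof
    fix x assume x: "x \<in> {x. hproj n c x \<in> A \<and> \<not> P (hproj n c x)}"
    \<comment> \<open>Translation by an integer multiple of the normal moves \<open>x\<close>
      into the slab of thickness 1 that defines the measure, without changing its
      projection.\<close>
    define m where "m = round (n \<bullet> x - c)"
    let ?y = "x + (- of_int m) *\<^sub>R n"
    have "n \<bullet> ?y - c = (n \<bullet> x - c) - of_int m"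
      using n by (simp add: inner_add_right dot_square_norm inner_diff_right)
    then have "\<bar>n \<bullet> ?y - c\<bar> \<le> 1/2"
      using of_int_round_abs_le [of "n \<bullet> x - c"] by (simp only: m_def abs_minus_commute)
    moreover have "hproj n c ?y = hproj n c x" using n by (rule hproj_shift)
    ultimately have "?y \<in> Z" using x N(3) n by (auto simp: Z_def inner_hproj)
    then have "x \<in> (+) (of_int m *\<^sub>R n) ` Z" by (intro image_eqI [where x = ?y]) auto
    then show "x \<in> (\<Union>m::int. (+) (of_int m *\<^sub>R n) ` Z)" by blast
  qed
  moreover have "negligible (\<Union>m::int. (+) (of_int m *\<^sub>R n) ` Z)"
    by (intro negligible_countable_Union) (auto intro: negligible_translation Z)
  ultimately show ?thesis by (rule negligible_subset [rotated])
qed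

text \<open>Either the direction \<open>v\<close> is parallel to the hyperplane, and the shadow
  lies in it, or a shear that turns the normal lines into lines of direction \<open>v\<close>
  reduces the claim to the case of orthogonal lines.\<close>

lemma negligible_shadow_hyperplane:
  fixes A :: "'a::euclidean_space set"
  assumes A: "A \<in> sets borel" and ae: "AE x in surface_measure A. P x"
    and H: "H \<in> hyperplanes"
  shows "negligible {y. \<exists>t::real. y + t *\<^sub>R v \<in> A \<inter> H \<and> \<not> P (y + t *\<^sub>R v)}" (is "negligible ?S")
proof -
  obtain n c where n: "norm n = 1" "H = {x. n \<bullet> x = c}" using H by (rule hyperplane_unit_normal)
  show ?thesis
  proof (cases "n \<bullet> v = 0")
    case True
    have "?S \<subseteq> {x. n \<bullet> x = c}" using n True by (auto simp: inner_add_right)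
    moreover have "n \<noteq> 0" using n by auto
    ultimately show ?thesis using negligible_hyperplane [of n c] negligible_subset by blast
  next
    case False
    \<comment> \<open>The line through \<open>x\<close> in the normal direction goes to the line
      of direction \<open>v\<close> through the same point of the hyperplane.\<close>
    let ?g = "\<lambda>x. hproj n c x - ((n \<bullet> x - c)) *\<^sub>R v"
    let ?Z = "{x. hproj n c x \<in> A \<and> \<not> P (hproj n c x)}"
    have "?S \<subseteq> ?g ` ?Z"
    proof
      fix y assume "y \<in> ?S"
      then obtain t where t: "y + t *\<^sub>R v \<in> A" "n \<bullet> (y + t *\<^sub>R v) = c" "\<not> P (y + t *\<^sub>R v)"
        using n by auto
      let ?x = "y + t *\<^sub>R v + t *\<^sub>R n"
      have p: "hproj n c ?x = y + t *\<^sub>R v"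
        using n t by (simp add: hproj_shift hproj_same)
      have "n \<bullet> ?x - c = t"
        using n t by (simp add: inner_add_right dot_square_norm)
      with p t show "y \<in> ?g ` ?Z" by (intro image_eqI [where x = ?x]) auto
    qed
    moreover have "?g differentiable_on ?Z"
      unfolding hproj_def
      by (intro differentiable_at_imp_differentiable_on) (auto intro!: derivative_intros)
    then have "negligible (?g ` ?Z)"
      using AE_surface_measure_lines [OF A ae n(1)]
      by (intro negligible_differentiable_image_negligible) auto
    ultimately show ?thesis by (rule negligible_subset [rotated])
  qed
qed

lemma negligible_shadow:
  fixes A :: "'a::euclidean_space set"
  assumes A: "A \<in> sets borel" "finite HS" "HS \<subseteq> hyperplanes" "A \<subseteq> \<Union>HS"
    and ae: "AE x in surface_measure A. P x"
  shows "negligible {y. \<exists>t::real. y + t *\<^sub>R v \<in> A \<and> \<not> P (y + t *\<^sub>R v)}"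
proof -
  have "negligible (\<Union>H\<in>HS. {y. \<exists>t::real. y + t *\<^sub>R v \<in> A \<inter> H \<and> \<not> P (y + t *\<^sub>R v)})"
    using A(2)
  proof (intro negligible_Union ballI)
    show "negligible X" if "X \<in> (\<lambda>H. {y. \<exists>t::real. y + t *\<^sub>R v \<in> A \<inter> H \<and> \<not> P (y + t *\<^sub>R v)}) ` HS" for X
      using that A(1,3) ae negligible_shadow_hyperplane [of A P] by blast
  qed simp
  then show ?thesis by (rule negligible_subset) (use A in blast)
qed

text \<open>Sweeping along a direction raises the dimension by at most one, so that a set of
  codimension two still has a null shadow.\<close>

lemma negligible_shadow_low_dim:
  fixes L :: "'a::euclidean_space set"
  assumes "aff_dim L \<le> int DIM('a) - 2"
  shows "negligible {y. \<exists>t::real. y + t *\<^sub>R v \<in> L}" (is "negligible ?S")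
proof (cases "L = {}")
  case False
  then obtain a where a: "a \<in> L" by blast
  let ?A = "affine hull (insert (a + v) L)"
  have "?S \<subseteq> ?A"
  proof
    fix y assume "y \<in> ?S"
    then obtain t where t: "y + t *\<^sub>R v \<in> L" by blast
    have in_A: "y + t *\<^sub>R v \<in> ?A" "a + v \<in> ?A" "a \<in> ?A" using t a by (auto intro: hull_inc)
    have "(y + t *\<^sub>R v) + t *\<^sub>R (a - (a + v)) \<in> ?A"
      using in_A by (intro mem_affine_3_minus affine_affine_hull)
    then show "y \<in> ?A" by (simp add: algebra_simps)
  qed
  moreover have "negligible ?A"
  proof -
    have "aff_dim ?A \<le> int DIM('a) - 1" using assms by (simp add: aff_dim_insert)
    then have "interior ?A = {}" using aff_dim_nonempty_interior [of ?A] by fastforce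
    then show ?thesis
      by (intro negligible_convex_interior [THEN iffD2] affine_imp_convex affine_affine_hull)
  qed
  ultimately show ?thesis by (rule negligible_subset [rotated])
qed simp

lemma AE_surface_measure_mem:
  assumes "A \<in> sets borel"
  shows "AE x in surface_measure A. x \<in> A"
proof (rule AE_I)
  show "{x \<in> space (surface_measure A). \<not> x \<in> A} \<subseteq> - A" by auto
  have "A \<inter> H \<inter> - A = {}" for H by blast
  then show "emeasure (surface_measure A) (- A) = 0"
    using assms by (subst emeasure_surface_measure) (auto simp: borel_comp)
  show "- A \<in> sets (surface_measure A)" using assms by (auto intro!: sets_surface_measure_borel borel_comp)
qed

text \<open>The relative boundary of a flat convex set projects from the frontier of a convex
  cylinder, which is a Lebesgue null set.\<close>

lemma AE_surface_measure_rel_interior: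
  assumes e: "compact e" "convex e" and H: "norm n = 1" "affine hull e = {x. n \<bullet> x = c}"
  shows "AE x in surface_measure e. x \<in> rel_interior e"
proof (rule AE_I)
  let ?H = "{x. n \<bullet> x = c}" and ?R = "rel_interior e"
  have Hm: "?H \<in> hyperplanes" using H(1) by (rule unit_hyperplane_in_hyperplanes)
  have eb: "e \<in> sets borel" using e by (auto intro: borel_closed compact_imp_closed)
  have eH: "e \<subseteq> ?H" using hull_subset [of e affine] H by simp
  have Rb: "?R \<in> sets borel"
  proof -
    have "openin (top_of_set ?H) ?R" using openin_rel_interior [of e] H by simp
    then obtain U where "open U" "?R = ?H \<inter> U" by (auto simp: openin_open)
    then show ?thesis by (auto intro!: sets.Int borel_closed closed_hyperplane)
  qed
  show "{x \<in> space (surface_measure e). \<not> x \<in> ?R} \<subseteq> - ?R" by auto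
  show "- ?R \<in> sets (surface_measure e)" using Rb by (auto intro!: sets_surface_measure_borel borel_comp)
  have "emeasure (hyperplane_measure G) (e \<inter> G \<inter> - ?R) = 0" if G: "G \<in> hyperplanes" for G
  proof (cases "G = ?H")
    case False
    have "e \<inter> G \<inter> - ?R \<in> sets borel" using eb Rb G hyperplanes_borel by (auto intro!: borel_comp)
    with False G Hm eH show ?thesis
      by (intro hyperplane_measure_other_hyperplane [of G ?H]) auto
  next
    case True
    let ?C = "hproj n c -` e"
    have "convex ?C"
    proof -
      have *: "hproj n c (u *\<^sub>R x + v *\<^sub>R y) = u *\<^sub>R hproj n c x + v *\<^sub>R hproj n c y"
        if "u + v = 1" for u v :: real and x y
      proof -
        have "u *\<^sub>R hproj n c x + v *\<^sub>R hproj n c y =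
            u *\<^sub>R x + v *\<^sub>R y - (n \<bullet> (u *\<^sub>R x + v *\<^sub>R y) - (u + v) * c) *\<^sub>R n"
          by (simp add: hproj_def inner_add_right algebra_simps)
        then show ?thesis using that by (simp add: hproj_def)
      qed
      show ?thesis
        using e(2) by (auto simp: convex_def *)
    qed
    then have neg: "negligible (frontier ?C)" by (rule negligible_convex_frontier)
    have "{x. \<bar>n \<bullet> x - c\<bar> \<le> 1/2 \<and> hproj n c x \<in> e \<inter> G \<inter> - ?R} \<subseteq> frontier ?C"
    proof
      fix x assume x: "x \<in> {x. \<bar>n \<bullet> x - c\<bar> \<le> 1/2 \<and> hproj n c x \<in> e \<inter> G \<inter> - ?R}"
      have "x \<notin> interior ?C"
      proof
        assume "x \<in> interior ?C"
        then obtain r where r: "r > 0" "ball x r \<subseteq> ?C" by (meson mem_interior)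
        have "ball (hproj n c x) r \<inter> affine hull e \<subseteq> e"
        proof
          fix y assume y: "y \<in> ball (hproj n c x) r \<inter> affine hull e"
          let ?z = "y + (n \<bullet> x - c) *\<^sub>R n"
          have "dist x ?z = dist (hproj n c x) y"
            by (simp add: dist_norm hproj_def algebra_simps)
          then have "?z \<in> ball x r" using y by simp
          then have "?z \<in> ?C" using r by blast
          then show "y \<in> e" using y H by (simp add: hproj_shift hproj_same)
        qed
        then have "hproj n c x \<in> ?R" using x r(1) by (auto simp: mem_rel_interior_ball)
        with x show False by auto
      qed
      with x closure_subset [of ?C] show "x \<in> frontier ?C" by (auto simp: frontier_def)
    qed
    with neg have "negligible {x. \<bar>n \<bullet> x - c\<bar> \<le> 1/2 \<and> hproj n c x \<in> e \<inter> G \<inter> - ?R}"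
      by (rule negligible_subset)
    moreover have b: "e \<inter> G \<inter> - ?R \<in> sets borel" using eb Rb G hyperplanes_borel by (auto intro!: borel_comp)
    then have "{x. \<bar>n \<bullet> x - c\<bar> \<le> 1/2 \<and> hproj n c x \<in> e \<inter> G \<inter> - ?R} \<in> sets lborel"
      by measurable
    ultimately have "emeasure lborel {x. \<bar>n \<bullet> x - c\<bar> \<le> 1/2 \<and> hproj n c x \<in> e \<inter> G \<inter> - ?R} = 0"
      by (auto simp: negligible_iff_null_sets null_sets_completion_iff null_sets_def)
    then show ?thesis using emeasure_hyperplane_measure [OF H(1) b, of c] True by simp
  qed
  then show "emeasure (surface_measure e) (- ?R) = 0"
    using eb Rb by (subst emeasure_surface_measure)
      (auto simp: borel_comp nn_integral_0_iff_AE AE_count_space)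
qed

text \<open>Completeness of the measure supplies the measurability of \<open>v\<close>. The jumps
  need this: the outward normal that occurs in them is a known constant only almost everywhere on
  a face.\<close>

lemma L2_completion_AE_cong:
  assumes u: "u \<in> L2 (completion M)" and eq: "AE x in completion M. u x = v x"
  shows "v \<in> L2 (completion M)"
proof -
  let ?N = "{x \<in> space (completion M). u x \<noteq> v x}"
  have N: "?N \<in> null_sets (completion M)" using eq by (simp add: completion.AE_iff_null_sets)
  have um: "u \<in> borel_measurable (completion M)" using u by (simp add: L2_def)
  have vm: "v \<in> borel_measurable (completion M)"
  proof (rule measurableI)
    fix A :: "complex set" assume A: "A \<in> sets borel"
    have "v -` A \<inter> space (completion M) =
        (u -` A \<inter> space (completion M) - ?N) \<union> (v -` A \<inter> ?N)" by auto
    moreover have "v -` A \<inter> ?N \<in> null_sets (completion M)"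
      using N by (rule completion.complete2 [rotated]) auto
    ultimately show "v -` A \<inter> space (completion M) \<in> sets (completion M)"
      using measurable_sets [OF um A] N by (auto simp: null_sets_def)
  qed simp
  have "integrable (completion M) (\<lambda>x. (cmod (v x))\<^sup>2)"
  proof (rule integrable_cong_AE_imp)
    show "integrable (completion M) (\<lambda>x. (cmod (u x))\<^sup>2)" using u by (simp add: L2_def)
    show "(\<lambda>x. (cmod (v x))\<^sup>2) \<in> borel_measurable (completion M)" using vm by measurable
    show "AE x in completion M. (cmod (u x))\<^sup>2 = (cmod (v x))\<^sup>2" using eq by eventually_elim simp
  qed
  with vm show ?thesis by (simp add: L2_def)
qed

lemma L2_surface_AE_cong:
  "u \<in> L2 (surface_measure A) \<Longrightarrow> AE x in surface_measure A. u x = v x \<Longrightarrow> v \<in> L2 (surface_measure A)"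
  unfolding surface_measure_def by (rule L2_completion_AE_cong)

section \<open>Normals of convex sets\<close>

text \<open>A point \<open>y\<close> near \<open>x\<close> on the proper side lies on the segment
  from \<open>z\<close> to a point \<open>y'\<close> of the hyperplane, and \<open>y'\<close> is
  near \<open>x\<close> up to a factor that does not depend on \<open>y\<close>.\<close>

lemma convex_contains_half_ball:
  fixes K :: "'a::euclidean_space set"
  assumes K: "convex K" "z \<in> K" "n \<bullet> z < c" and n: "norm n = 1" "n \<bullet> x = c"
    and r: "r > 0" "ball x r \<inter> {y. n \<bullet> y = c} \<subseteq> K"
  obtains s where "s > 0" "\<And>y. dist x y < s \<Longrightarrow> n \<bullet> y \<le> c \<Longrightarrow> y \<in> K"
proof -
  define d where "d = c - n \<bullet> z"
  have d: "d > 0" using K by (simp add: d_def)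
  define C where "C = 1 + norm (z - x) / d"
  have C: "C > 0" using d by (simp add: C_def add_pos_nonneg)
  define s where "s = min (d / 2) (r / (2 * C))"
  have "y \<in> K" if y: "dist x y < s" "n \<bullet> y \<le> c" for y
  proof -
    define t where "t = (c - n \<bullet> y) / d"
    have "c - n \<bullet> y = n \<bullet> (x - y)" using n by (simp add: inner_diff_right)
    also have "\<dots> \<le> norm (x - y)" using norm_cauchy_schwarz [of n "x - y"] n by simp
    finally have ny: "c - n \<bullet> y \<le> dist x y" by (simp add: dist_norm)
    have t0: "t \<ge> 0" using y d by (simp add: t_def)
    have "c - n \<bullet> y \<le> d / 2" using y ny by (simp add: s_def)
    then have t: "t \<le> 1/2" "t \<le> dist x y / d"
      unfolding t_def using ny d divide_right_mono [of "c - n \<bullet> y" "dist x y" d]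
        divide_right_mono [of "c - n \<bullet> y" "d / 2" d] by simp_all
    define y' where "y' = (1 / (1 - t)) *\<^sub>R (y - t *\<^sub>R z)"
    have yy: "y = (1 - t) *\<^sub>R y' + t *\<^sub>R z" using t by (simp add: y'_def)
    have "n \<bullet> y = (1 - t) * (n \<bullet> y') + t * (n \<bullet> z)"
      by (subst yy) (simp add: inner_add_right)
    moreover have "t * (n \<bullet> z) = t * c - (c - n \<bullet> y)"
      using d by (simp add: t_def d_def field_simps)
    ultimately have "(1 - t) * (n \<bullet> y') = (1 - t) * c" by (simp add: algebra_simps)
    then have ny': "n \<bullet> y' = c" using t by simp
    have "(1 - t) *\<^sub>R y' = y - t *\<^sub>R z" using t by (simp add: y'_def)
    then have "(1 - t) *\<^sub>R (y' - x) = (y - x) - t *\<^sub>R (z - x)"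
      by (simp add: algebra_simps)
    then have "norm ((1 - t) *\<^sub>R (y' - x)) = norm ((y - x) - t *\<^sub>R (z - x))" by simp
    then have "(1 - t) * norm (y' - x) = norm ((y - x) - t *\<^sub>R (z - x))" using t by simp
    also have "\<dots> \<le> norm (y - x) + t * norm (z - x)"
      using norm_triangle_ineq4 [of "y - x" "t *\<^sub>R (z - x)"] t0 by simp
    also have "\<dots> \<le> dist x y + dist x y / d * norm (z - x)"
      using t by (intro add_mono mult_right_mono) (auto simp: dist_norm norm_minus_commute)
    also have "\<dots> = dist x y * C" by (simp add: C_def algebra_simps)
    finally have "(1 - t) * norm (y' - x) \<le> dist x y * C" .
    moreover have "1/2 * norm (y' - x) \<le> (1 - t) * norm (y' - x)"
      using t by (intro mult_right_mono) auto
    ultimately have "norm (y' - x) \<le> 2 * (dist x y * C)" by linarith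
    also have "\<dots> < r" using y(1) C by (simp add: s_def field_simps)
    finally have "y' \<in> K" using r(2) ny' by (auto simp: dist_norm norm_minus_commute)
    then show ?thesis
      unfolding yy using K t0 t by (intro convexD) auto
  qed
  moreover have "s > 0" using d C r by (simp add: s_def)
  ultimately show thesis using that by blast
qed

text \<open>Near a relative interior point of a flat boundary piece, a convex set coincides with a
  half space; its normal is the only outward normal, since for any other unit vector
  \<open>m\<close> the direction \<open>m - n\<close> points into the half space but to the outer
  side of \<open>m\<close>.\<close>

lemma outward_normal_eq:
  fixes K :: "'a::euclidean_space set"
  assumes K: "closed K" "convex K" "z \<in> K" "n \<bullet> z < c" "K \<subseteq> {y. n \<bullet> y \<le> c}"
    and n: "norm n = 1" "n \<bullet> x = c" and r: "r > 0" "ball x r \<inter> {y. n \<bullet> y = c} \<subseteq> K"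
  shows "outward_normal K x = n"
proof -
  obtain s where s: "s > 0" "\<And>y. dist x y < s \<Longrightarrow> n \<bullet> y \<le> c \<Longrightarrow> y \<in> K"
    using convex_contains_half_ball [OF K(2-4) n r] by blast
  have on: "outward_unit_normal K x n"
    unfolding outward_unit_normal_def
  proof (intro conjI allI impI)
    have "x \<in> K" using s n by simp
    moreover have "x \<notin> interior K"
    proof
      assume "x \<in> interior K"
      then obtain \<rho> where \<rho>: "\<rho> > 0" "ball x \<rho> \<subseteq> K" by (meson mem_interior)
      have "x + (\<rho>/2) *\<^sub>R n \<in> ball x \<rho>" using \<rho> n by (simp add: dist_norm)
      then have "n \<bullet> (x + (\<rho>/2) *\<^sub>R n) \<le> c" using \<rho> K by blast
      with n \<rho> show False by (simp add: inner_add_right dot_square_norm)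
    qed
    ultimately show "x \<in> frontier K" using K by (simp add: frontier_def)
    fix \<epsilon> :: real assume \<epsilon>: "\<epsilon> > 0"
    show "\<exists>r>0. \<forall>y\<in>ball x r.
        ((y - x) \<bullet> n < - \<epsilon> * norm (y - x) \<longrightarrow> y \<in> K) \<and>
        ((y - x) \<bullet> n > \<epsilon> * norm (y - x) \<longrightarrow> y \<notin> K)"
    proof (intro exI [of _ s] conjI ballI impI)
      fix y assume y: "y \<in> ball x s"
      have ny: "n \<bullet> y = c + (y - x) \<bullet> n" using n by (simp add: inner_diff_right inner_commute [of "y - x"])
      have e: "\<epsilon> * norm (y - x) \<ge> 0" using \<epsilon> by simp
      show "y \<in> K" if "(y - x) \<bullet> n < - \<epsilon> * norm (y - x)"
        using that e ny y by (intro s(2)) auto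
      show "y \<notin> K" if "(y - x) \<bullet> n > \<epsilon> * norm (y - x)"
        using that e ny K(5) by auto
    qed (rule s)
  qed (use n in auto)
  have unique: "m = n" if m: "outward_unit_normal K x m" for m
  proof (rule ccontr)
    assume "m \<noteq> n"
    have mn: "norm m = 1" using m by (simp add: outward_unit_normal_def)
    \<comment> \<open>Going from \<open>x\<close> a short way in the direction \<open>m -
      n\<close> leads to a point that \<open>n\<close> puts inside \<open>K\<close> and
      \<open>m\<close> outside.\<close>
    define v where "v = m - n"
    have v: "norm v > 0" using \<open>m \<noteq> n\<close> by (simp add: v_def)
    define a where "a = 1 - m \<bullet> n"
    have "v \<bullet> v = m \<bullet> m - 2 * (m \<bullet> n) + n \<bullet> n"
      unfolding v_def by (simp only: inner_diff_left inner_diff_right inner_commute [of n m])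
    then have "v \<bullet> v = 2 * a" using mn n by (simp add: norm_eq_1 a_def)
    then have "(norm v)\<^sup>2 = 2 * a" by (simp only: power2_norm_eq_inner)
    then have a: "a > 0" using v by (metis zero_less_power zero_less_mult_iff zero_less_numeral order_less_asym)
    have vn: "v \<bullet> n = - a" "v \<bullet> m = a"
      using mn n by (simp_all add: v_def a_def inner_diff_left norm_eq_1 inner_commute [of n m])
    define \<epsilon> where "\<epsilon> = a / (2 * norm v)"
    have \<epsilon>: "\<epsilon> > 0" using a v by (simp add: \<epsilon>_def)
    obtain r1 where r1: "r1 > 0" "\<And>y. y \<in> ball x r1 \<Longrightarrow> (y - x) \<bullet> n < - \<epsilon> * norm (y - x) \<Longrightarrow> y \<in> K"
      using on \<epsilon> unfolding outward_unit_normal_def by blast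
    obtain r2 where r2: "r2 > 0" "\<And>y. y \<in> ball x r2 \<Longrightarrow> (y - x) \<bullet> m > \<epsilon> * norm (y - x) \<Longrightarrow> y \<notin> K"
      using m \<epsilon> unfolding outward_unit_normal_def by blast
    define t where "t = min r1 r2 / (2 * norm v)"
    have t: "t > 0" using r1 r2 v by (simp add: t_def)
    define y where "y = x + t *\<^sub>R v"
    have tv: "t * norm v = min r1 r2 / 2" using v by (simp add: t_def)
    have yb: "y \<in> ball x r1" "y \<in> ball x r2"
      using tv t r1(1) r2(1) by (auto simp: y_def dist_norm)
    have \<epsilon>v: "\<epsilon> * norm (y - x) = t * (a / 2)"
      using t v by (simp add: y_def \<epsilon>_def)
    have ta: "t * a > 0" using t a by simp
    have "(y - x) \<bullet> n = - (t * a)" "(y - x) \<bullet> m = t * a" by (simp_all add: y_def vn)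
    then have "(y - x) \<bullet> n < - \<epsilon> * norm (y - x)" "(y - x) \<bullet> m > \<epsilon> * norm (y - x)"
      using \<epsilon>v ta by simp_all
    then show False using r1(2) [OF yb(1)] r2(2) [OF yb(2)] by blast
  qed
  show ?thesis
    unfolding outward_normal_def using on unique by (rule the_equality)
qed

section \<open>Elements and their interior faces\<close>

locale mesh =
  fixes \<Omega> :: "(real^'d) set" and T :: "(real^'d) set set"
  assumes open_domain: "open \<Omega>" and bounded_domain: "bounded \<Omega>"
    and partition: "mesh_partition \<Omega> T"
begin

lemma finite_mesh: "finite T"
  using partition by (simp add: mesh_partition_def)

lemma simplex: "K \<in> T \<Longrightarrow> int DIM(real^'d) simplex K"
  using partition by (simp only: mesh_partition_def)

lemma interior_subset_domain: "K \<in> T \<Longrightarrow> interior K \<subseteq> \<Omega>"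
  using partition by (simp only: mesh_partition_def)

lemma interiors_disjoint:
  "K \<in> T \<Longrightarrow> K' \<in> T \<Longrightarrow> K \<noteq> K' \<Longrightarrow> interior K \<inter> interior K' = {}"
  using partition unfolding mesh_partition_def by meson

lemma Union_mesh: "\<Union>T = closure \<Omega>"
  using partition by (simp add: mesh_partition_def)

lemma compact_element: "K \<in> T \<Longrightarrow> compact K"
  and convex_element: "K \<in> T \<Longrightarrow> convex K"
  and closed_element: "K \<in> T \<Longrightarrow> closed K"
  using simplex compact_simplex convex_simplex closed_simplex by blast+

lemma affine_hull_element: "K \<in> T \<Longrightarrow> affine hull K = UNIV"
  using aff_dim_simplex [OF simplex] aff_dim_eq_full by blast

lemma interior_element_nonempty:
  assumes "K \<in> T" shows "interior K \<noteq> {}"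
proof -
  have "aff_dim K = int DIM(real^'d)" using simplex [OF assms] by (rule aff_dim_simplex)
  have "rel_interior K = interior K"
    using affine_hull_element [OF assms] by (rule rel_interior_interior)
  moreover have "K \<noteq> {}" using \<open>aff_dim K = _\<close> by auto
  ultimately show ?thesis using convex_element [OF assms] rel_interior_eq_empty by metis
qed

lemma element_eq_closure_interior: "K \<in> T \<Longrightarrow> closure (interior K) = K"
  using convex_closure_interior convex_element interior_element_nonempty closed_element closure_closed
  by metis

lemma boundary_in_hyperplanes:
  obtains HS where "finite HS" "HS \<subseteq> hyperplanes" "frontier \<Omega> \<subseteq> \<Union>HS"
proof
  let ?HS = "\<Union>K\<in>T. (\<lambda>F. affine hull F) ` {F. F facet_of K}"
  have poly: "polytope K" if "K \<in> T" for K
    using simplex [OF that] simplex_imp_polytope by blast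
  show "finite ?HS"
    using finite_mesh finite_polytope_facets poly by auto
  show "?HS \<subseteq> hyperplanes"
  proof
    fix H assume "H \<in> ?HS"
    then obtain K F where K: "K \<in> T" and F: "F facet_of K" and H: "H = affine hull F" by auto
    have "aff_dim F = aff_dim K - 1" using F by (simp add: facet_of_def)
    then show "H \<in> hyperplanes"
      using aff_dim_simplex [OF simplex [OF K]] H by (simp add: hyperplanes_def)
  qed
  show "frontier \<Omega> \<subseteq> \<Union>?HS"
  proof
    fix x assume "x \<in> frontier \<Omega>"
    then have x: "x \<in> closure \<Omega>" "x \<notin> \<Omega>"
      using open_domain by (auto simp: frontier_def interior_open)
    then obtain K where K: "K \<in> T" "x \<in> K" using Union_mesh by blast
    have "x \<notin> interior K" using interior_subset_domain K x by blast
    have "rel_frontier K = frontier K"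
      using affine_hull_element [OF K(1)] by (simp add: rel_frontier_def frontier_def rel_interior_interior)
    moreover have "x \<in> frontier K"
      using K \<open>x \<notin> interior K\<close> closure_subset by (auto simp: frontier_def)
    ultimately obtain F where "F facet_of K" "x \<in> F"
      using rel_frontier_of_polyhedron [OF polytope_imp_polyhedron [OF poly [OF K(1)]]] by blast
    then show "x \<in> \<Union>?HS" using K hull_subset [of F affine] by blast
  qed
qed

lemma boundary_borel: "frontier \<Omega> \<in> sets borel"
  by (simp add: borel_closed)

lemma bounded_boundary: "bounded (frontier \<Omega>)"
  using bounded_domain bounded_subset [of "closure \<Omega>" "frontier \<Omega>"] by (auto simp: frontier_def)

lemma finite_boundary_measure: "finite_measure (surface_measure (frontier \<Omega>))"
proof -
  obtain HS where "finite HS" "HS \<subseteq> hyperplanes" "frontier \<Omega> \<subseteq> \<Union>HS"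
    by (rule boundary_in_hyperplanes)
  then show ?thesis
    using boundary_borel bounded_domain bounded_boundary by (intro surface_measure_finite [of _ HS]) auto
qed

lemma separate_elements:
  assumes "K \<in> T" "K' \<in> T" "K \<noteq> K'"
  obtains n c where "norm n = 1" "K \<subseteq> {x. n \<bullet> x \<le> c}" "K' \<subseteq> {x. n \<bullet> x \<ge> c}"
proof -
  obtain a b where ab: "a \<noteq> 0" "\<forall>x\<in>interior K. a \<bullet> x \<le> b" "\<forall>x\<in>interior K'. a \<bullet> x \<ge> b"
    using separating_hyperplane_sets [of "interior K" "interior K'"]
      convex_interior convex_element interior_element_nonempty interiors_disjoint assms
    by (metis)
  have "closure (interior K) \<subseteq> {x. a \<bullet> x \<le> b}"
    by (intro closure_minimal closed_halfspace_le) (use ab in blast)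
  moreover have "closure (interior K') \<subseteq> {x. a \<bullet> x \<ge> b}"
    by (intro closure_minimal closed_halfspace_ge) (use ab in blast)
  ultimately have sub: "K \<subseteq> {x. a \<bullet> x \<le> b}" "K' \<subseteq> {x. a \<bullet> x \<ge> b}"
    using assms element_eq_closure_interior by auto
  have "a \<bullet> x \<le> b \<longleftrightarrow> (a /\<^sub>R norm a) \<bullet> x \<le> b / norm a" "b \<le> a \<bullet> x \<longleftrightarrow> b / norm a \<le> (a /\<^sub>R norm a) \<bullet> x" for x
    using ab(1) by (simp_all add: field_simps)
  with sub ab(1) show thesis
    by (intro that [of "a /\<^sub>R norm a" "b / norm a"]) auto
qed

lemma strictly_inside_half_space:
  assumes "K \<in> T" "K \<subseteq> {x. n \<bullet> x \<le> c}" "n \<noteq> 0"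
  obtains z where "z \<in> K" "n \<bullet> z < c"
proof -
  obtain z where z: "z \<in> interior K" using interior_element_nonempty assms by blast
  have "interior K \<subseteq> interior {x. n \<bullet> x \<le> c}" using assms(2) by (rule interior_mono)
  then have "n \<bullet> z < c" using z assms(3) interior_halfspace_le [of n c] by auto
  with z interior_subset that show thesis by blast
qed

text \<open>The two elements that define the face lie on opposite sides of a hyperplane, which the
  face spans. Near a relative interior point of the face they fill both half balls, so there is no
  room for a third element, and their normals are opposite.\<close>

lemma interior_faceE:
  assumes "e \<in> interior_faces T"
  obtains K\<^sub>1 K\<^sub>2 n c where "K\<^sub>1 \<in> T" "K\<^sub>2 \<in> T" "K\<^sub>1 \<noteq> K\<^sub>2" "e = K\<^sub>1 \<inter> K\<^sub>2" "{K\<in>T. e \<subseteq> K} = {K\<^sub>1, K\<^sub>2}"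
    "norm n = 1" "affine hull e = {x. n \<bullet> x = c}"
    "\<And>x. x \<in> rel_interior e \<Longrightarrow> outward_normal K\<^sub>1 x = n \<and> outward_normal K\<^sub>2 x = - n"
proof -
  obtain K\<^sub>1 K\<^sub>2 where K: "K\<^sub>1 \<in> T" "K\<^sub>2 \<in> T" "K\<^sub>1 \<noteq> K\<^sub>2" and e: "e = K\<^sub>1 \<inter> K\<^sub>2"
    and dim: "aff_dim e = int DIM(real^'d) - 1"
    using assms unfolding interior_faces_def by blast
  obtain n c where n: "norm n = 1" and sub: "K\<^sub>1 \<subseteq> {x. n \<bullet> x \<le> c}" "K\<^sub>2 \<subseteq> {x. n \<bullet> x \<ge> c}"
    using separate_elements K by metis
  have n0: "n \<noteq> 0" using n by auto
  let ?H = "{x. n \<bullet> x = c}"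
  have "e \<subseteq> ?H" using e sub by fastforce
  have e_ne: "e \<noteq> {}" using dim DIM_positive [where 'a = "real^'d"] by (auto simp: aff_dim_empty)
  have hull: "affine hull e = ?H"
  proof (rule affine_dim_equal)
    show "affine hull e \<subseteq> ?H" using \<open>e \<subseteq> ?H\<close> by (intro hull_minimal affine_hyperplane)
    show "aff_dim (affine hull e) = aff_dim ?H"
      using dim aff_dim_hyperplane [OF n0] by (simp add: of_nat_diff)
  qed (use e_ne affine_hyperplane in auto)
  have sub2: "K\<^sub>2 \<subseteq> {x. (- n) \<bullet> x \<le> - c}" using sub by auto
  obtain z\<^sub>1 where z\<^sub>1: "z\<^sub>1 \<in> K\<^sub>1" "n \<bullet> z\<^sub>1 < c"
    using strictly_inside_half_space [OF K(1) sub(1) n0] by blast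
  obtain z\<^sub>2 where z\<^sub>2: "z\<^sub>2 \<in> K\<^sub>2" "(- n) \<bullet> z\<^sub>2 < - c"
    using strictly_inside_half_space [OF K(2) sub2] n0 by auto
  have ri: "\<exists>r>0. ball x r \<inter> ?H \<subseteq> e" "n \<bullet> x = c" if "x \<in> rel_interior e" for x
    using that hull rel_interior_subset [of e] \<open>e \<subseteq> ?H\<close> by (auto simp: mem_rel_interior_ball)
  have Hm: "{y. (- n) \<bullet> y = - c} = ?H" by auto
  have normals: "outward_normal K\<^sub>1 x = n \<and> outward_normal K\<^sub>2 x = - n" if x: "x \<in> rel_interior e" for x
  proof -
    obtain r where r: "r > 0" "ball x r \<inter> ?H \<subseteq> e" using ri [OF x] by blast
    have "outward_normal K\<^sub>1 x = n"
      by (rule outward_normal_eq [of K\<^sub>1 z\<^sub>1 n c x r])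
        (use K z\<^sub>1 sub n r ri [OF x] e closed_element convex_element in auto)
    moreover have "outward_normal K\<^sub>2 x = - n"
      by (rule outward_normal_eq [of K\<^sub>2 z\<^sub>2 "- n" "- c" x r])
        (use K z\<^sub>2 sub2 n r ri [OF x] e closed_element convex_element Hm in auto)
    ultimately show ?thesis ..
  qed
  \<comment> \<open>A third element containing the face would have interior points near
    \<open>x\<close> off the hyperplane, and these are interior to one of the two half
    balls.\<close>
  have third: "K = K\<^sub>1 \<or> K = K\<^sub>2" if KT: "K \<in> T" and eK: "e \<subseteq> K" for K
  proof (rule ccontr)
    assume ne: "\<not> (K = K\<^sub>1 \<or> K = K\<^sub>2)"
    have "convex e" using K e convex_element convex_Int by blast
    then obtain x where x: "x \<in> rel_interior e" using e_ne rel_interior_eq_empty by blast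
    obtain r where r: "r > 0" "ball x r \<inter> ?H \<subseteq> e" using ri [OF x] by blast
    obtain s\<^sub>1 where s\<^sub>1: "s\<^sub>1 > 0" "\<And>y. dist x y < s\<^sub>1 \<Longrightarrow> n \<bullet> y \<le> c \<Longrightarrow> y \<in> K\<^sub>1"
      by (rule convex_contains_half_ball [of K\<^sub>1 z\<^sub>1 n c x r])
        (use K z\<^sub>1 n r ri [OF x] e convex_element in auto)
    obtain s\<^sub>2 where s\<^sub>2: "s\<^sub>2 > 0" "\<And>y. dist x y < s\<^sub>2 \<Longrightarrow> (- n) \<bullet> y \<le> - c \<Longrightarrow> y \<in> K\<^sub>2"
      by (rule convex_contains_half_ball [of K\<^sub>2 z\<^sub>2 "- n" "- c" x r])
        (use K z\<^sub>2 n r ri [OF x] e convex_element Hm in auto)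
    let ?B = "ball x (min s\<^sub>1 s\<^sub>2)"
    have "x \<in> closure (interior K)"
      using eK x rel_interior_subset element_eq_closure_interior [OF KT] by blast
    moreover have "x \<in> ?B" using s\<^sub>1 s\<^sub>2 by simp
    ultimately have W: "?B \<inter> interior K \<noteq> {}"
      using open_Int_closure_eq_empty [OF open_ball, of x "min s\<^sub>1 s\<^sub>2" "interior K"] by blast
    have "open (?B \<inter> interior K)" by auto
    then have "\<not> ?B \<inter> interior K \<subseteq> ?H"
      using W n0 interior_hyperplane [of n c] interior_maximal by (metis subset_empty)
    then obtain w where w: "w \<in> ?B" "w \<in> interior K" "n \<bullet> w \<noteq> c" by blast
    show False
    proof (cases "n \<bullet> w < c")
      case True
      have "?B \<inter> {y. n \<bullet> y < c} \<subseteq> interior K\<^sub>1"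
        using s\<^sub>1(2) by (intro interior_maximal open_Int open_ball open_halfspace_lt) auto
      with True w ne KT K interiors_disjoint show False by blast
    next
      case False
      have "?B \<inter> {y. n \<bullet> y > c} \<subseteq> interior K\<^sub>2"
        using s\<^sub>2(2) by (intro interior_maximal open_Int open_ball open_halfspace_gt) auto
      moreover have "n \<bullet> w > c" using False w by simp
      ultimately show False using w ne KT K interiors_disjoint by blast
    qed
  qed
  then have "{K\<in>T. e \<subseteq> K} = {K\<^sub>1, K\<^sub>2}" using K e by blast
  with K e n hull normals show thesis by (intro that) auto
qed

lemma finite_interior_faces: "finite (interior_faces T)"
proof -
  have "interior_faces T \<subseteq> (\<lambda>(K, K'). K \<inter> K') ` (T \<times> T)" by (auto simp: interior_faces_def)
  then show ?thesis using finite_mesh finite_subset by blast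
qed

lemma face_compact_convex:
  assumes "e \<in> interior_faces T" shows "compact e" "convex e"
  using assms compact_element convex_element unfolding interior_faces_def
  by (auto intro: compact_Int convex_Int)

lemma face_borel: "e \<in> interior_faces T \<Longrightarrow> e \<in> sets borel"
  using face_compact_convex compact_imp_closed borel_closed by blast

lemma finite_face_measure:
  assumes e: "e \<in> interior_faces T" shows "finite_measure (surface_measure e)"
proof -
  obtain n c where "norm n = 1" "affine hull e = {x. n \<bullet> x = c}"
    using e by (rule interior_faceE)
  then have "affine hull e \<in> hyperplanes" by (simp add: unit_hyperplane_in_hyperplanes)
  then show ?thesis
    using face_borel [OF e] face_compact_convex [OF e] compact_imp_bounded hull_subset [of e affine]
    by (intro surface_measure_finite [of _ "{affine hull e}"]) auto
qed

section \<open>Traces of discrete functions\<close>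

lemma sets_element: "K \<in> T \<Longrightarrow> K \<in> sets lebesgue"
  using compact_element lmeasurable_compact fmeasurableD by blast

lemma sets_domain: "\<Omega> \<in> sets lebesgue"
  using open_domain lmeasurable_open bounded_domain fmeasurableD by blast

text \<open>An element may stick out of the open domain, but only with boundary points.\<close>

lemma AE_domain_imp_element:
  assumes "AE x in lebesgue_on \<Omega>. P x" "K \<in> T"
  shows "AE x in lebesgue_on K. P x"
proof -
  have "negligible {x\<in>\<Omega>. \<not> P x}" using assms AE_lebesgue_on_iff [OF sets_domain] by blast
  moreover have "negligible (frontier K)" using convex_element assms negligible_convex_frontier by blast
  ultimately have "negligible ({x\<in>\<Omega>. \<not> P x} \<union> frontier K)" by (rule negligible_Un)
  moreover have "{x\<in>K. \<not> P x} \<subseteq> {x\<in>\<Omega>. \<not> P x} \<union> frontier K"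
    using interior_subset_domain assms(2) closure_subset by (fastforce simp: frontier_def)
  ultimately have "negligible {x\<in>K. \<not> P x}" by (rule negligible_subset)
  then show ?thesis using AE_lebesgue_on_iff [OF sets_element] assms by blast
qed

lemma AE_elements_imp_domain:
  assumes "\<And>K. K \<in> T \<Longrightarrow> AE x in lebesgue_on K. P x"
  shows "AE x in lebesgue_on \<Omega>. P x"
proof -
  have "negligible (\<Union>K\<in>T. {x\<in>K. \<not> P x})"
    using assms AE_lebesgue_on_iff [OF sets_element] finite_mesh by (intro negligible_Union) auto
  moreover have "{x\<in>\<Omega>. \<not> P x} \<subseteq> (\<Union>K\<in>T. {x\<in>K. \<not> P x})"
    using Union_mesh closure_subset by blast
  ultimately have "negligible {x\<in>\<Omega>. \<not> P x}" by (rule negligible_subset)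
  then show ?thesis using AE_lebesgue_on_iff [OF sets_domain] by blast
qed

lemma piece_cong:
  assumes "AE x in lebesgue_on \<Omega>. u x = v x" "K \<in> T"
  shows "piece u K = piece v K"
proof -
  have "AE x in lebesgue_on K. u x = v x" using AE_domain_imp_element assms by blast
  then have "(AE x in lebesgue_on K. u x = p x) \<longleftrightarrow> (AE x in lebesgue_on K. v x = p x)" for p
    by (intro iffI) (auto elim: eventually_elim2)
  then show ?thesis by (simp add: piece_def)
qed

lemma
  assumes "v \<in> V_h \<Omega> T" "K \<in> T"
  shows piece_P1c: "piece v K \<in> P1c" and AE_piece: "AE x in lebesgue_on K. v x = piece v K x"
proof -
  obtain p where p: "p \<in> P1c" "AE x in lebesgue_on K. v x = p x"
    using assms by (auto simp: V_h_def)
  then have "piece v K = p"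
    using assms compact_element interior_element_nonempty by (intro piece_eqI) auto
  with p show "piece v K \<in> P1c" "AE x in lebesgue_on K. v x = piece v K x" by auto
qed

lemma AE_comb_pieces:
  assumes "u \<in> V_h \<Omega> T" "v \<in> V_h \<Omega> T" "K \<in> T"
  shows "AE x in lebesgue_on K. u x + c * v x = piece u K x + c * piece v K x"
  using AE_piece [OF assms(1,3)] AE_piece [OF assms(2,3)] by eventually_elim simp

lemma piece_comb:
  assumes "u \<in> V_h \<Omega> T" "v \<in> V_h \<Omega> T" "K \<in> T"
  shows "piece (\<lambda>x. u x + c * v x) K = (\<lambda>x. piece u K x + c * piece v K x)"
  using assms AE_comb_pieces compact_element interior_element_nonempty
  by (intro piece_eqI P1c_comb piece_P1c) auto

lemma V_h_comb:
  assumes "u \<in> V_h \<Omega> T" "v \<in> V_h \<Omega> T"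
  shows "(\<lambda>x. u x + c * v x) \<in> V_h \<Omega> T"
proof -
  have "(\<lambda>x. u x + c * v x) \<in> L2 (lebesgue_on \<Omega>)" using assms by (intro L2_comb) (auto simp: V_h_def)
  moreover have "\<exists>p\<in>P1c. AE x in lebesgue_on K. u x + c * v x = p x" if "K \<in> T" for K
    using AE_comb_pieces [OF assms that] P1c_comb [OF piece_P1c [OF assms(1) that] piece_P1c [OF assms(2) that]]
    by (intro bexI)
  ultimately show ?thesis by (simp add: V_h_def)
qed

lemma V_h_L2: "v \<in> V_h \<Omega> T \<Longrightarrow> v \<in> L2 (lebesgue_on \<Omega>)"
  by (simp add: V_h_def)

lemma V_h_AE_eqI:
  assumes "u \<in> V_h \<Omega> T" "v \<in> V_h \<Omega> T" "\<And>K. K \<in> T \<Longrightarrow> piece u K = piece v K"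
  shows "AE x in lebesgue_on \<Omega>. u x = v x"
proof (rule AE_elements_imp_domain)
  fix K assume K: "K \<in> T"
  show "AE x in lebesgue_on K. u x = v x"
    using AE_piece [OF assms(1) K] AE_piece [OF assms(2) K] by eventually_elim (simp add: assms(3) K)
qed

text \<open>Where no element has the point in its interior the value is the default 0; within the
  mesh these points form a null set.\<close>

definition glue :: "((real^'d) set \<Rightarrow> real^'d \<Rightarrow> complex) \<Rightarrow> real^'d \<Rightarrow> complex" where
  "glue p x = (\<Sum>K\<in>{K\<in>T. x \<in> interior K}. p K x)"

lemma sum_restricted_elements:
  fixes f :: "(real^'d) set \<Rightarrow> complex"
  shows "(\<Sum>K\<in>{K\<in>T. P K}. f K) = (\<Sum>K\<in>T. of_bool (P K) * f K)"
  using finite_mesh by (simp add: sum.inter_filter of_bool_def if_distrib [of "\<lambda>a. a * _"] cong: if_cong)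

lemma glue_eq: "glue p = (\<lambda>x. \<Sum>K\<in>T. indicator (interior K) x * p K x)"
  by (simp add: glue_def sum_restricted_elements indicator_def fun_eq_iff)

lemma finite_domain_measure: "finite_measure (lebesgue_on \<Omega>)"
  using open_domain bounded_domain by (intro finite_measure_lebesgue_on lmeasurable_open)

lemma AE_glue:
  assumes "K \<in> T" shows "AE x in lebesgue_on K. glue p x = p K x"
proof -
  have "glue p x = p K x" if "x \<in> interior K" for x
  proof -
    have "{K\<in>T. x \<in> interior K} = {K}" using that assms interiors_disjoint by blast
    then show ?thesis by (simp add: glue_def)
  qed
  then have "{x\<in>K. glue p x \<noteq> p K x} \<subseteq> frontier K"
    using closure_subset by (fastforce simp: frontier_def)
  moreover have "negligible (frontier K)" using convex_element assms negligible_convex_frontier by blast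
  ultimately show ?thesis using AE_lebesgue_on_iff [OF sets_element] assms negligible_subset by blast
qed

lemma glue_V_h:
  assumes "\<And>K. K \<in> T \<Longrightarrow> p K \<in> P1c"
  shows "glue p \<in> V_h \<Omega> T"
proof -
  have meas: "f \<in> borel_measurable (lebesgue_on \<Omega>)" if "f \<in> borel_measurable borel" for f :: "real^'d \<Rightarrow> complex"
    using that by (intro measurable_restrict_space1 measurable_completion) simp
  have "AE x in lebesgue_on \<Omega>. x \<in> \<Omega>" by (rule AE_I2) (simp add: space_restrict_space)
  then have "(\<lambda>x. indicator (interior K) x * p K x) \<in> L2 (lebesgue_on \<Omega>)" if "K \<in> T" for K
    by (rule L2_indicator_P1c [OF finite_domain_measure _ bounded_domain meas assms [OF that]
          borel_open [OF open_interior]])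
  then have "glue p \<in> L2 (lebesgue_on \<Omega>)"
    unfolding glue_eq using finite_mesh by (intro L2_sum)
  then show ?thesis using AE_glue assms by (auto simp: V_h_def)
qed

lemma piece_glue: "K \<in> T \<Longrightarrow> p K \<in> P1c \<Longrightarrow> piece (glue p) K = p K"
  using compact_element interior_element_nonempty AE_glue by (intro piece_eqI) auto

lemma Sigma_h_component: "\<tau> \<in> Sigma_h \<Omega> T \<Longrightarrow> (\<lambda>x. \<tau> x $ i) \<in> V_h \<Omega> T"
  by (simp add: Sigma_h_def)

lemma Sigma_h_comb: "\<sigma> \<in> Sigma_h \<Omega> T \<Longrightarrow> \<tau> \<in> Sigma_h \<Omega> T \<Longrightarrow> (\<lambda>x. \<sigma> x + c *s \<tau> x) \<in> Sigma_h \<Omega> T"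
  by (simp add: Sigma_h_def V_h_comb)

lemma Sigma_h_L2v: "\<tau> \<in> Sigma_h \<Omega> T \<Longrightarrow> \<tau> \<in> L2v (lebesgue_on \<Omega>)"
  by (simp add: Sigma_h_def L2v_def V_h_L2)

lemma vpiece_comb:
  assumes "\<sigma> \<in> Sigma_h \<Omega> T" "\<tau> \<in> Sigma_h \<Omega> T" "K \<in> T"
  shows "vpiece (\<lambda>x. \<sigma> x + c *s \<tau> x) K x = vpiece \<sigma> K x + c *s vpiece \<tau> K x"
  using piece_comb [OF Sigma_h_component [OF assms(1)] Sigma_h_component [OF assms(2)] assms(3)]
  by (simp add: vpiece_def vec_eq_iff)

lemma broken_grad_component: "broken_grad T v x $ i = glue (\<lambda>K x. grad (piece v K) x $ i) x"
  by (simp add: broken_grad_def glue_def)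

lemma broken_grad_Sigma_h:
  assumes v: "v \<in> V_h \<Omega> T"
  shows "broken_grad T v \<in> Sigma_h \<Omega> T"
proof -
  have "glue (\<lambda>K x. grad (piece v K) x $ i) \<in> V_h \<Omega> T" for i
    by (intro glue_V_h grad_component_P1c piece_P1c [OF v])
  then show ?thesis by (simp add: Sigma_h_def broken_grad_component)
qed

lemma vpiece_broken_grad:
  assumes "v \<in> V_h \<Omega> T" "K \<in> T"
  shows "vpiece (broken_grad T v) K x = grad (piece v K) x"
  using assms by (simp add: vpiece_def broken_grad_component piece_glue grad_component_P1c piece_P1c vec_eq_iff)

lemma broken_grad_comb:
  assumes "u \<in> V_h \<Omega> T" "v \<in> V_h \<Omega> T"
  shows "broken_grad T (\<lambda>x. u x + c * v x) = (\<lambda>x. broken_grad T u x + c *s broken_grad T v x)"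
proof
  fix x
  have "broken_grad T (\<lambda>x. u x + c * v x) x =
      (\<Sum>K\<in>{K\<in>T. x \<in> interior K}. grad (piece u K) x + c *s grad (piece v K) x)"
    unfolding broken_grad_def using assms
    by (intro sum.cong) (auto simp: piece_comb grad_P1c_comb piece_P1c)
  then show "broken_grad T (\<lambda>x. u x + c * v x) x = broken_grad T u x + c *s broken_grad T v x"
    by (simp add: broken_grad_def vec_eq_iff sum.distrib sum_distrib_left)
qed

lemma boundary_trace_comb:
  assumes "u \<in> V_h \<Omega> T" "v \<in> V_h \<Omega> T"
  shows "boundary_trace T (\<lambda>x. u x + c * v x) = (\<lambda>x. boundary_trace T u x + c * boundary_trace T v x)"
proof
  fix x
  have "boundary_trace T (\<lambda>x. u x + c * v x) x =
      (\<Sum>K\<in>{K\<in>T. x \<in> K}. piece u K x + c * piece v K x)"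
    unfolding boundary_trace_def using assms by (intro sum.cong) (auto simp: piece_comb)
  then show "boundary_trace T (\<lambda>x. u x + c * v x) x = boundary_trace T u x + c * boundary_trace T v x"
    by (simp add: boundary_trace_def sum.distrib sum_distrib_left)
qed

lemma jump_comb:
  assumes "u \<in> V_h \<Omega> T" "v \<in> V_h \<Omega> T"
  shows "jump T (\<lambda>x. u x + c * v x) e = (\<lambda>x. jump T u e x + c *s jump T v e x)"
  using assms by (simp add: jump_def piece_comb fun_eq_iff vec_eq_iff sum.distrib sum_distrib_left algebra_simps)

lemma vavg_comb:
  assumes "\<sigma> \<in> Sigma_h \<Omega> T" "\<tau> \<in> Sigma_h \<Omega> T"
  shows "vavg T (\<lambda>x. \<sigma> x + c *s \<tau> x) e = (\<lambda>x. vavg T \<sigma> e x + c *s vavg T \<tau> e x)"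
  using assms by (simp add: vavg_def vpiece_comb fun_eq_iff vec_eq_iff sum.distrib sum_distrib_left scaleR_add_right)

lemma vjump_comb:
  assumes "\<sigma> \<in> Sigma_h \<Omega> T" "\<tau> \<in> Sigma_h \<Omega> T"
  shows "vjump T (\<lambda>x. \<sigma> x + c *s \<tau> x) e = (\<lambda>x. vjump T \<sigma> e x + c * vjump T \<tau> e x)"
  using assms by (simp add: vjump_def vpiece_comb fun_eq_iff sum.distrib sum_distrib_left algebra_simps)

lemma boundary_trace_L2:
  assumes "v \<in> V_h \<Omega> T" shows "boundary_trace T v \<in> L2 (surface_measure (frontier \<Omega>))"
proof -
  have "boundary_trace T v = (\<lambda>x. \<Sum>K\<in>T. indicator K x * piece v K x)"
    by (simp add: boundary_trace_def sum_restricted_elements indicator_def fun_eq_iff)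
  moreover have "(\<lambda>x. indicator K x * piece v K x) \<in> L2 (surface_measure (frontier \<Omega>))" if "K \<in> T" for K
    by (rule L2_indicator_P1c [OF finite_boundary_measure AE_surface_measure_mem [OF boundary_borel]
          bounded_boundary borel_measurable_surface_measure piece_P1c [OF assms that]
          borel_closed [OF closed_element [OF that]]])
  ultimately show ?thesis using finite_mesh by (simp only: L2_sum)
qed

lemma piece_face_L2:
  assumes "e \<in> interior_faces T" "v \<in> V_h \<Omega> T" "K \<in> T"
  shows "piece v K \<in> L2 (surface_measure e)"
  using L2_indicator_P1c [OF finite_face_measure [OF assms(1)] AE_surface_measure_mem [OF face_borel [OF assms(1)]],
      of "piece v K" UNIV]
    face_compact_convex(1) [OF assms(1)] compact_imp_bounded borel_measurable_surface_measure piece_P1c [OF assms(2,3)]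
  by auto

lemma vavg_L2:
  assumes "e \<in> interior_faces T" "\<tau> \<in> Sigma_h \<Omega> T"
  shows "vavg T \<tau> e \<in> L2v (surface_measure e)"
proof -
  have "(\<lambda>x. complex_of_real (1/2) * (\<Sum>K\<in>{K\<in>T. e \<subseteq> K}. piece (\<lambda>y. \<tau> y $ i) K x)) \<in> L2 (surface_measure e)" for i
    using assms finite_mesh Sigma_h_component by (intro L2_scale L2_sum piece_face_L2) auto
  moreover have "vavg T \<tau> e x $ i = complex_of_real (1/2) * (\<Sum>K\<in>{K\<in>T. e \<subseteq> K}. piece (\<lambda>y. \<tau> y $ i) K x)" for x i
    by (simp add: vavg_def vpiece_def) (simp add: scaleR_conv_of_real)
  ultimately show ?thesis by (simp only: L2v_def mem_Collect_eq) blast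
qed

text \<open>The jumps expressed by the difference of the two one-sided traces and by one constant
  normal.\<close>

lemma AE_face_jumps:
  assumes "e \<in> interior_faces T"
  obtains K\<^sub>1 K\<^sub>2 n c where "K\<^sub>1 \<in> T" "K\<^sub>2 \<in> T" "{K\<in>T. e \<subseteq> K} = {K\<^sub>1, K\<^sub>2}"
    "norm n = 1" "affine hull e = {x. n \<bullet> x = c}"
    "\<And>v i. AE x in surface_measure e. (piece v K\<^sub>1 x - piece v K\<^sub>2 x) * of_real (n $ i) = jump T v e x $ i"
    "\<And>\<tau>. AE x in surface_measure e.
      (\<Sum>i\<in>UNIV. (vpiece \<tau> K\<^sub>1 x $ i - vpiece \<tau> K\<^sub>2 x $ i) * of_real (n $ i)) = vjump T \<tau> e x"
proof -
  obtain K\<^sub>1 K\<^sub>2 n c where K: "K\<^sub>1 \<in> T" "K\<^sub>2 \<in> T" "K\<^sub>1 \<noteq> K\<^sub>2"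
    and two: "{K\<in>T. e \<subseteq> K} = {K\<^sub>1, K\<^sub>2}" and n: "norm n = 1" "affine hull e = {x. n \<bullet> x = c}"
    and nor: "\<And>x. x \<in> rel_interior e \<Longrightarrow> outward_normal K\<^sub>1 x = n \<and> outward_normal K\<^sub>2 x = - n"
    using assms by (rule interior_faceE) blast
  have ae: "AE x in surface_measure e. x \<in> rel_interior e"
    using face_compact_convex [OF assms] n by (rule AE_surface_measure_rel_interior)
  have "AE x in surface_measure e. (piece v K\<^sub>1 x - piece v K\<^sub>2 x) * of_real (n $ i) = jump T v e x $ i" for v i
    using ae by eventually_elim (use nor K(3) in \<open>simp add: jump_def two algebra_simps\<close>)
  moreover have "AE x in surface_measure e.
      (\<Sum>i\<in>UNIV. (vpiece \<tau> K\<^sub>1 x $ i - vpiece \<tau> K\<^sub>2 x $ i) * of_real (n $ i)) = vjump T \<tau> e x" for \<tau>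
    using ae by eventually_elim (use nor K(3) in \<open>simp add: vjump_def two algebra_simps sum_subtractf sum_negf\<close>)
  ultimately show thesis using that K two n by blast
qed

lemma jump_L2:
  assumes e: "e \<in> interior_faces T" and v: "v \<in> V_h \<Omega> T"
  shows "jump T v e \<in> L2v (surface_measure e)"
proof -
  obtain K\<^sub>1 K\<^sub>2 n c where K: "K\<^sub>1 \<in> T" "K\<^sub>2 \<in> T"
    and j: "\<And>v i. AE x in surface_measure e.
      (piece v K\<^sub>1 x - piece v K\<^sub>2 x) * of_real (n $ i) = jump T v e x $ i"
    using e by (rule AE_face_jumps) blast
  have "(\<lambda>x. of_real (n $ i) * (piece v K\<^sub>1 x + (- 1) * piece v K\<^sub>2 x)) \<in> L2 (surface_measure e)" for i
    using K e v by (intro L2_scale L2_comb piece_face_L2)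
  then have "(\<lambda>x. (piece v K\<^sub>1 x - piece v K\<^sub>2 x) * of_real (n $ i)) \<in> L2 (surface_measure e)" for i
    by (simp add: mult.commute)
  then show ?thesis using L2_surface_AE_cong [OF _ j] by (simp add: L2v_def)
qed

lemma vjump_L2:
  assumes e: "e \<in> interior_faces T" and \<tau>: "\<tau> \<in> Sigma_h \<Omega> T"
  shows "vjump T \<tau> e \<in> L2 (surface_measure e)"
proof -
  obtain K\<^sub>1 K\<^sub>2 n c where K: "K\<^sub>1 \<in> T" "K\<^sub>2 \<in> T"
    and j: "\<And>\<tau>. AE x in surface_measure e.
      (\<Sum>i\<in>UNIV. (vpiece \<tau> K\<^sub>1 x $ i - vpiece \<tau> K\<^sub>2 x $ i) * of_real (n $ i)) = vjump T \<tau> e x"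
    using e by (rule AE_face_jumps) blast
  have "(\<lambda>x. \<Sum>i\<in>UNIV. of_real (n $ i) * (piece (\<lambda>y. \<tau> y $ i) K\<^sub>1 x + (- 1) * piece (\<lambda>y. \<tau> y $ i) K\<^sub>2 x))
      \<in> L2 (surface_measure e)"
    using K e \<tau> Sigma_h_component by (intro L2_sum L2_scale L2_comb piece_face_L2) auto
  then have "(\<lambda>x. \<Sum>i\<in>UNIV. (vpiece \<tau> K\<^sub>1 x $ i - vpiece \<tau> K\<^sub>2 x $ i) * of_real (n $ i))
      \<in> L2 (surface_measure e)"
    by (simp add: vpiece_def mult.commute)
  then show ?thesis using j by (rule L2_surface_AE_cong)
qed

section \<open>The LDG form\<close>

text \<open>One interior face's share of the form, with the penalty term separated from the
  average in the numerical flux.\<close>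

definition face_form ::
    "real \<Rightarrow> real \<Rightarrow> (real^'d) set \<Rightarrow> (real^'d \<Rightarrow> complex) \<Rightarrow> (real^'d \<Rightarrow> complex^'d) \<Rightarrow>
      (real^'d \<Rightarrow> complex) \<Rightarrow> (real^'d \<Rightarrow> complex^'d) \<Rightarrow> complex" where
  "face_form \<beta> \<delta> e w \<zeta> v \<tau> =
     \<i> * of_real \<beta> * vip (surface_measure e) (jump T w e) (jump T v e)
     - \<i> * of_real \<delta> * ip (surface_measure e) (vjump T \<zeta> e) (vjump T \<tau> e)
     + vip (surface_measure e) (jump T w e) (vavg T \<tau> e)
     - vip (surface_measure e) (vavg T \<zeta> e) (jump T v e)"

lemma B_h_eq:
  assumes "w \<in> V_h \<Omega> T" "\<zeta> \<in> Sigma_h \<Omega> T" "v \<in> V_h \<Omega> T" "\<tau> \<in> Sigma_h \<Omega> T"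
  shows "B_h \<Omega> T k \<beta> \<delta> w \<zeta> v \<tau> =
     vip (lebesgue_on \<Omega>) \<zeta> (broken_grad T v)
     - (of_real k)\<^sup>2 * ip (lebesgue_on \<Omega>) w v
     + \<i> * of_real k * ip (surface_measure (frontier \<Omega>)) (boundary_trace T w) (boundary_trace T v)
     + (\<Sum>e\<in>interior_faces T. face_form \<beta> \<delta> e w \<zeta> v \<tau>)
     + vip (lebesgue_on \<Omega>) \<zeta> \<tau> - vip (lebesgue_on \<Omega>) (broken_grad T w) \<tau>"
proof -
  have flux: "vip (surface_measure e)
        (\<lambda>x. vavg T \<zeta> e x - (\<chi> i. \<i> * of_real \<beta> * jump T w e x $ i)) (jump T v e) =
      vip (surface_measure e) (vavg T \<zeta> e) (jump T v e)
      - \<i> * of_real \<beta> * vip (surface_measure e) (jump T w e) (jump T v e)"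
    if e: "e \<in> interior_faces T" for e
  proof -
    have "(\<lambda>x. vavg T \<zeta> e x - (\<chi> i. \<i> * of_real \<beta> * jump T w e x $ i)) =
        (\<lambda>x. vavg T \<zeta> e x + (- (\<i> * of_real \<beta>)) *s jump T w e x)"
      by (simp add: fun_eq_iff vec_eq_iff)
    then show ?thesis
      using vip_comb_left [OF vavg_L2 [OF e assms(2)] jump_L2 [OF e assms(1)] jump_L2 [OF e assms(3)],
          of "- (\<i> * of_real \<beta>)"]
      by simp
  qed
  show ?thesis
    unfolding B_h_def face_form_def
    by (simp add: flux sum_subtractf sum.distrib)
qed

lemma face_form_comb_left:
  assumes "e \<in> interior_faces T" "w \<in> V_h \<Omega> T" "\<zeta> \<in> Sigma_h \<Omega> T" "w' \<in> V_h \<Omega> T" "\<zeta>' \<in> Sigma_h \<Omega> T"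
    "v \<in> V_h \<Omega> T" "\<tau> \<in> Sigma_h \<Omega> T"
  shows "face_form \<beta> \<delta> e (\<lambda>x. w x + c * w' x) (\<lambda>x. \<zeta> x + c *s \<zeta>' x) v \<tau> =
    face_form \<beta> \<delta> e w \<zeta> v \<tau> + c * face_form \<beta> \<delta> e w' \<zeta>' v \<tau>"
  using assms
  by (simp add: face_form_def jump_comb vjump_comb vavg_comb vip_comb_left ip_comb_left
      jump_L2 vjump_L2 vavg_L2 algebra_simps)

lemma face_form_comb_right:
  assumes "e \<in> interior_faces T" "w \<in> V_h \<Omega> T" "\<zeta> \<in> Sigma_h \<Omega> T" "v \<in> V_h \<Omega> T" "\<tau> \<in> Sigma_h \<Omega> T"
    "v' \<in> V_h \<Omega> T" "\<tau>' \<in> Sigma_h \<Omega> T"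
  shows "face_form \<beta> \<delta> e w \<zeta> (\<lambda>x. v x + c * v' x) (\<lambda>x. \<tau> x + c *s \<tau>' x) =
    face_form \<beta> \<delta> e w \<zeta> v \<tau> + cnj c * face_form \<beta> \<delta> e w \<zeta> v' \<tau>'"
  using assms
  by (simp add: face_form_def jump_comb vjump_comb vavg_comb vip_comb_right ip_comb_right
      jump_L2 vjump_L2 vavg_L2 algebra_simps)

lemma B_h_comb_left:
  assumes "w \<in> V_h \<Omega> T" "\<zeta> \<in> Sigma_h \<Omega> T" "w' \<in> V_h \<Omega> T" "\<zeta>' \<in> Sigma_h \<Omega> T"
    "v \<in> V_h \<Omega> T" "\<tau> \<in> Sigma_h \<Omega> T"
  shows "B_h \<Omega> T k \<beta> \<delta> (\<lambda>x. w x + c * w' x) (\<lambda>x. \<zeta> x + c *s \<zeta>' x) v \<tau> =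
    B_h \<Omega> T k \<beta> \<delta> w \<zeta> v \<tau> + c * B_h \<Omega> T k \<beta> \<delta> w' \<zeta>' v \<tau>"
  using assms
  by (simp add: B_h_eq V_h_comb Sigma_h_comb face_form_comb_left boundary_trace_comb broken_grad_comb
      vip_comb_left ip_comb_left V_h_L2 Sigma_h_L2v broken_grad_Sigma_h boundary_trace_L2
      sum.distrib flip: sum_distrib_left) (simp add: algebra_simps)

lemma B_h_comb_right:
  assumes "w \<in> V_h \<Omega> T" "\<zeta> \<in> Sigma_h \<Omega> T" "v \<in> V_h \<Omega> T" "\<tau> \<in> Sigma_h \<Omega> T"
    "v' \<in> V_h \<Omega> T" "\<tau>' \<in> Sigma_h \<Omega> T"
  shows "B_h \<Omega> T k \<beta> \<delta> w \<zeta> (\<lambda>x. v x + c * v' x) (\<lambda>x. \<tau> x + c *s \<tau>' x) =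
    B_h \<Omega> T k \<beta> \<delta> w \<zeta> v \<tau> + cnj c * B_h \<Omega> T k \<beta> \<delta> w \<zeta> v' \<tau>'"
  using assms
  by (simp add: B_h_eq V_h_comb Sigma_h_comb face_form_comb_right boundary_trace_comb broken_grad_comb
      vip_comb_right ip_comb_right V_h_L2 Sigma_h_L2v broken_grad_Sigma_h boundary_trace_L2
      sum.distrib flip: sum_distrib_left) (simp add: algebra_simps)

lemma zero_V_h: "(\<lambda>x. 0) \<in> V_h \<Omega> T"
  using V_h_comb [of "glue (\<lambda>K. affc 0 0)" "glue (\<lambda>K. affc 0 0)" "-1"] glue_V_h [of "\<lambda>K. affc 0 0"]
  by (simp add: affc_in_P1c)

lemma zero_Sigma_h: "(\<lambda>x. 0) \<in> Sigma_h \<Omega> T"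
  by (simp add: Sigma_h_def zero_V_h)

lemma null_pieces:
  assumes "AE x in lebesgue_on \<Omega>. v x = 0" "K \<in> T"
  shows "piece v K = (\<lambda>x. 0)"
proof -
  have "(\<lambda>x. 0) \<in> (P1c :: (real^'d \<Rightarrow> complex) set)"
    using affc_in_P1c [of 0 0] by (simp add: affc_def [abs_def])
  then show ?thesis
    using AE_domain_imp_element [OF assms] compact_element interior_element_nonempty assms
    by (intro piece_eqI) auto
qed

text \<open>The traces are built from the polynomial pieces, so they vanish identically, not only
  almost everywhere, when the function vanishes almost everywhere.\<close>

lemma null_traces:
  assumes "AE x in lebesgue_on \<Omega>. v x = 0"
  shows "broken_grad T v = (\<lambda>x. 0)" "boundary_trace T v = (\<lambda>x. 0)" "jump T v e = (\<lambda>x. 0)"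
proof -
  have g: "grad (\<lambda>x. 0) x = (0 :: complex^'d)" for x :: "real^'d"
    using grad_affc [of 0 0 x] by (simp add: affc_def [abs_def])
  have "grad (piece v K) x = 0" if "K \<in> T" for K x by (simp only: null_pieces [OF assms that] g)
  then show "broken_grad T v = (\<lambda>x. 0)" by (auto simp: broken_grad_def fun_eq_iff intro!: sum.neutral)
  show "boundary_trace T v = (\<lambda>x. 0)" "jump T v e = (\<lambda>x. 0)"
    using null_pieces [OF assms]
    by (auto simp: boundary_trace_def jump_def fun_eq_iff vec_eq_iff intro!: sum.neutral)
qed

lemma null_vtraces:
  assumes "AE x in lebesgue_on \<Omega>. \<tau> x = 0"
  shows "vavg T \<tau> e = (\<lambda>x. 0)" "vjump T \<tau> e = (\<lambda>x. 0)"
proof -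
  have "AE x in lebesgue_on \<Omega>. \<tau> x $ i = 0" for i using assms by eventually_elim simp
  then have "vpiece \<tau> K x = 0" if "K \<in> T" for K x
    using null_pieces that by (simp add: vpiece_def vec_eq_iff)
  then show "vavg T \<tau> e = (\<lambda>x. 0)" "vjump T \<tau> e = (\<lambda>x. 0)"
    by (auto simp: vavg_def vjump_def fun_eq_iff intro!: sum.neutral)
qed

lemma B_h_null_right:
  assumes "w \<in> V_h \<Omega> T" "\<zeta> \<in> Sigma_h \<Omega> T" "v \<in> V_h \<Omega> T" "\<tau> \<in> Sigma_h \<Omega> T"
    and v: "AE x in lebesgue_on \<Omega>. v x = 0" and \<tau>: "AE x in lebesgue_on \<Omega>. \<tau> x = 0"
  shows "B_h \<Omega> T k \<beta> \<delta> w \<zeta> v \<tau> = 0"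
  using assms by (simp add: B_h_eq null_traces null_vtraces face_form_def ip_AE_0 vip_AE_0)

section \<open>Propagation along rays\<close>

lemma elements_meet_in_hyperplane:
  assumes "K \<in> T" "K' \<in> T" "K \<noteq> K'"
  shows "aff_dim (K \<inter> K') \<le> int DIM(real^'d) - 1"
proof -
  obtain n c where n: "norm n = 1" "K \<subseteq> {x. n \<bullet> x \<le> c}" "K' \<subseteq> {x. n \<bullet> x \<ge> c}"
    using separate_elements [OF assms] .
  then have "K \<inter> K' \<subseteq> {x. n \<bullet> x = c}" by fastforce
  then have "aff_dim (K \<inter> K') \<le> aff_dim {x. n \<bullet> x = c}" by (rule aff_dim_subset)
  moreover have "n \<noteq> 0" using n by auto
  ultimately show ?thesis using aff_dim_hyperplane [of n c] by (simp add: of_nat_diff)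
qed

text \<open>The condition \<open>match\<close> compares only elements with a common face. Two
  elements whose pieces differ therefore meet in codimension at least two, and a generic ray
  avoids all such intersections.\<close>

lemma matching_pieces_vanish:
  assumes P1: "\<And>K. K \<in> T \<Longrightarrow> p K \<in> P1c"
    and match: "\<And>K K'. K \<in> T \<Longrightarrow> K' \<in> T \<Longrightarrow> K \<noteq> K' \<Longrightarrow>
      aff_dim (K \<inter> K') = int DIM(real^'d) - 1 \<Longrightarrow> p K = p K'"
    and bdry: "AE x in surface_measure (frontier \<Omega>). (\<Sum>K\<in>{K\<in>T. x \<in> K}. p K x) = 0"
    and K: "K \<in> T"
  shows "p K = (\<lambda>x. 0)"
proof (rule ccontr)
  assume nz: "p K \<noteq> (\<lambda>x. 0)"
  obtain \<alpha> \<beta> where pK: "p K = affc \<alpha> \<beta>" using P1 [OF K] by (auto simp: P1c_eq_affc)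
  have "\<exists>z\<in>interior K. p K z \<noteq> 0"
  proof (rule ccontr)
    assume "\<not> ?thesis"
    then have "{x\<in>interior K. p K x \<noteq> affc 0 0 x} = {}" by (auto simp: affc_def)
    then have "negligible {x\<in>interior K. p K x \<noteq> affc 0 0 x}" by (simp only: negligible_empty)
    then have "p K = affc 0 0"
      using P1 [OF K] affc_in_P1c interior_element_nonempty [OF K] open_not_negligible [OF open_interior]
      by (intro P1c_eqI [of _ _ "interior K"]) blast+
    with nz show False by (simp add: affc_def [abs_def])
  qed
  then obtain z where z: "z \<in> interior K" "p K z \<noteq> 0" by blast
  \<comment> \<open>The factor \<open>\<omega>\<close> turns \<open>p K\<close> so that the real
    part is positive at \<open>z\<close>.\<close>
  define \<omega> where "\<omega> = cnj (p K z)"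
  define b where "b = (\<chi> i. Re (\<omega> * \<beta> $ i))"
  define q where "q x = Re (\<omega> * p K x)" for x
  have "\<omega> * affc \<alpha> \<beta> x = affc (\<omega> * \<alpha>) (\<omega> *s \<beta>) x" for x
    by (simp add: affc_def distrib_left sum_distrib_left mult.assoc)
  then have q: "q x = Re (\<omega> * \<alpha>) + b \<bullet> x" for x
    unfolding q_def pK by (simp only: Re_affc) (simp add: b_def)
  have "\<omega> * p K z = of_real ((cmod (p K z))\<^sup>2)"
    unfolding \<omega>_def by (simp only: complex_norm_square mult.commute)
  then have qz: "q z > 0" using z(2) by (simp add: q_def)
  \<comment> \<open>The direction of the ray: \<open>q\<close> does not decrease along
    it.\<close>
  obtain v where v: "v \<noteq> 0" "b \<bullet> v \<ge> 0"
  proof (cases "b = 0")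
    case True
    then show thesis using that [of 1] by simp
  next
    case False
    then show thesis using that [of b] by simp
  qed
  define G where "G x \<longleftrightarrow> (\<Sum>K\<in>{K\<in>T. x \<in> K}. p K x) = 0" for x
  let ?N1 = "{y. \<exists>t::real. y + t *\<^sub>R v \<in> frontier \<Omega> \<and> \<not> G (y + t *\<^sub>R v)}"
  define low where "low = {K \<inter> K' | K K'. K \<in> T \<and> K' \<in> T \<and> aff_dim (K \<inter> K') \<le> int DIM(real^'d) - 2}"
  let ?N2 = "\<Union>L\<in>low. {y. \<exists>t::real. y + t *\<^sub>R v \<in> L}"
  obtain HS where "finite HS" "HS \<subseteq> hyperplanes" "frontier \<Omega> \<subseteq> \<Union>HS"
    by (rule boundary_in_hyperplanes)
  then have N1: "negligible ?N1"
    using boundary_borel bdry by (intro negligible_shadow [of _ HS]) (auto simp: G_def)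
  have "low \<subseteq> (\<lambda>(K, K'). K \<inter> K') ` (T \<times> T)" by (auto simp: low_def)
  then have "finite low" using finite_mesh finite_subset by blast
  then have N2: "negligible ?N2"
    by (intro negligible_Union) (auto simp: low_def intro!: negligible_shadow_low_dim)
  let ?U0 = "interior K \<inter> {y. - Re (\<omega> * \<alpha>) < b \<bullet> y}"
  have "open ?U0" by (intro open_Int open_interior open_halfspace_gt)
  moreover have "z \<in> ?U0" using z qz q [of z] by auto
  ultimately have "\<not> negligible ?U0" using open_not_negligible by blast
  then obtain y where y: "y \<in> ?U0" "y \<notin> ?N1" "y \<notin> ?N2"
    using negligible_subset [OF negligible_Un [OF N1 N2], of ?U0] by blast
  have "y \<in> interior \<Omega>" using y(1) interior_subset_domain [OF K] open_domain by (auto simp: interior_open)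
  then obtain d where d: "d > 0" "y + d *\<^sub>R v \<in> frontier \<Omega>"
    and inside: "\<And>t. 0 \<le> t \<Longrightarrow> t < d \<Longrightarrow> y + t *\<^sub>R v \<in> interior \<Omega>"
    using ray_to_frontier [OF bounded_domain _ v(1)] by blast
  define seg where "seg = (\<lambda>t. y + t *\<^sub>R v) ` {0..d}"
  have "connected seg" unfolding seg_def by (intro connected_continuous_image continuous_intros) auto
  \<comment> \<open>The elements with the piece \<open>p K\<close> and the others form two
    closed sets that cover the connected segment and, by the choice of \<open>y\<close>, do not
    meet on it.\<close>
  define S where "S = {K'\<in>T. p K' = p K}"
  have "seg \<subseteq> closure \<Omega>"
  proof
    fix x assume "x \<in> seg"
    then obtain t where t: "x = y + t *\<^sub>R v" "t \<in> {0..d}" unfolding seg_def by blast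
    then show "x \<in> closure \<Omega>"
      using inside [of t] d interior_subset [of \<Omega>] closure_subset [of \<Omega>]
      by (cases "t = d") (auto simp: frontier_def)
  qed
  then have cover: "seg \<subseteq> \<Union>S \<union> \<Union>(T - S)" unfolding Union_mesh [symmetric] by blast
  have disj: "\<Union>S \<inter> \<Union>(T - S) \<inter> seg = {}"
  proof (rule ccontr)
    assume "\<not> ?thesis"
    then obtain x K' K'' where x: "x \<in> seg" "K' \<in> S" "x \<in> K'" "K'' \<in> T" "K'' \<notin> S" "x \<in> K''" by blast
    then have K': "K' \<in> T" "K' \<noteq> K''" "p K' \<noteq> p K''" by (auto simp: S_def)
    then have "aff_dim (K' \<inter> K'') \<noteq> int DIM(real^'d) - 1" using match x by blast
    moreover have "aff_dim (K' \<inter> K'') \<le> int DIM(real^'d) - 1"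
      using elements_meet_in_hyperplane K' x by blast
    ultimately have "aff_dim (K' \<inter> K'') \<le> int DIM(real^'d) - 2" by linarith
    then have "K' \<inter> K'' \<in> low" using K' x by (auto simp: low_def)
    moreover obtain t where "x = y + t *\<^sub>R v" using x(1) unfolding seg_def by blast
    ultimately have "y \<in> ?N2" using x by blast
    with y(3) show False by contradiction
  qed
  have "closed (\<Union>S)" "closed (\<Union>(T - S))"
    using finite_mesh closed_element by (auto simp: S_def intro!: closed_Union)
  moreover have "y \<in> seg" using d by (auto simp: seg_def intro!: image_eqI [where x = 0])
  moreover have "y \<in> \<Union>S"
  proof
    show "y \<in> K" using y(1) interior_subset by blast
    show "K \<in> S" using K by (simp add: S_def)
  qed
  ultimately have "\<Union>(T - S) \<inter> seg = {}"
    using \<open>connected seg\<close> cover disj unfolding connected_closed by blast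
  moreover define x where "x = y + d *\<^sub>R v"
  moreover have "x \<in> seg" using d by (auto simp: x_def seg_def)
  ultimately have same: "p K' = p K" if "K' \<in> T" "x \<in> K'" for K'
    using that by (auto simp: S_def)
  have "G x" using y(2) d(2) by (auto simp: x_def)
  then have "of_nat (card {K\<in>T. x \<in> K}) * p K x = 0"
    using same by (simp add: G_def)
  moreover have "x \<in> \<Union>T" using d Union_mesh by (auto simp: x_def frontier_def)
  then have "card {K\<in>T. x \<in> K} \<noteq> 0" using finite_mesh by auto
  ultimately have "p K x = 0" by simp
  then have "q x = 0" by (simp add: q_def)
  moreover have "q x = q y + d * (b \<bullet> v)" by (simp add: q x_def inner_add_right)
  moreover have "q y > 0" using y(1) by (simp add: q)
  moreover have "d * (b \<bullet> v) \<ge> 0" using d v by simp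
  ultimately show False by linarith
qed

text \<open>On the face the difference of the two pieces vanishes because \<open>w\<close> has no
  jump. Its derivative in the normal direction vanishes because \<open>\<zeta>\<close>, which has
  no normal jump either, is the piecewise gradient. So the difference is constant along the
  normals to the face and vanishes on a set of positive volume.\<close>

lemma pieces_agree_across_face:
  assumes e: "e \<in> interior_faces T" and w: "w \<in> V_h \<Omega> T"
    and grad: "\<And>K x. K \<in> T \<Longrightarrow> vpiece \<zeta> K x = grad (piece w K) x"
    and jw: "AE x in surface_measure e. jump T w e x = 0"
    and jchi: "AE x in surface_measure e. vjump T \<zeta> e x = 0"
    and K: "K \<in> T" "K' \<in> T" "e \<subseteq> K" "e \<subseteq> K'"
  shows "piece w K = piece w K'"
proof -
  obtain K\<^sub>1 K\<^sub>2 n c where K12: "K\<^sub>1 \<in> T" "K\<^sub>2 \<in> T" and two: "{K\<in>T. e \<subseteq> K} = {K\<^sub>1, K\<^sub>2}"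
    and n: "norm n = 1" and H: "affine hull e = {x. n \<bullet> x = c}"
    and j: "\<And>v i. AE x in surface_measure e.
      (piece v K\<^sub>1 x - piece v K\<^sub>2 x) * of_real (n $ i) = jump T v e x $ i"
    and vj: "\<And>\<tau>. AE x in surface_measure e.
      (\<Sum>i\<in>UNIV. (vpiece \<tau> K\<^sub>1 x $ i - vpiece \<tau> K\<^sub>2 x $ i) * of_real (n $ i)) = vjump T \<tau> e x"
    using e by (rule AE_face_jumps) blast
  obtain \<alpha>\<^sub>1 \<beta>\<^sub>1 \<alpha>\<^sub>2 \<beta>\<^sub>2 where p: "piece w K\<^sub>1 = affc \<alpha>\<^sub>1 \<beta>\<^sub>1" "piece w K\<^sub>2 = affc \<alpha>\<^sub>2 \<beta>\<^sub>2"
    using piece_P1c [OF w K12(1)] piece_P1c [OF w K12(2)] by (auto simp: P1c_eq_affc)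
  define \<alpha> \<beta> where "\<alpha> = \<alpha>\<^sub>1 - \<alpha>\<^sub>2" and "\<beta> = \<beta>\<^sub>1 - \<beta>\<^sub>2"
  have diff: "piece w K\<^sub>1 x - piece w K\<^sub>2 x = affc \<alpha> \<beta> x" for x
    using affc_comb [of \<alpha>\<^sub>1 \<beta>\<^sub>1 x "-1" \<alpha>\<^sub>2 \<beta>\<^sub>2] by (simp add: p \<alpha>_def \<beta>_def)
  let ?\<nu> = "\<Sum>i\<in>UNIV. \<beta> $ i * of_real (n $ i)"
  obtain i where i: "n $ i \<noteq> 0" using n by (metis norm_zero vec_eq_iff zero_index zero_neq_one)
  have "AE x in surface_measure e. affc \<alpha> \<beta> x = 0 \<and> ?\<nu> = 0"
    using j [of w i] vj [of \<zeta>] jw jchi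
  proof eventually_elim
    case (elim x)
    have "?\<nu> = 0" using elim(2,4) by (simp add: grad K12 p grad_affc \<beta>_def)
    moreover have "affc \<alpha> \<beta> x = 0" using elim(1,3) i diff [of x] by simp
    ultimately show ?case by simp
  qed
  then have neg: "negligible {x. hproj n c x \<in> e \<and> \<not> (affc \<alpha> \<beta> (hproj n c x) = 0 \<and> ?\<nu> = 0)}"
    by (intro AE_surface_measure_lines face_borel e n)
  define S where "S = {x. hproj n c x \<in> e}"
  have S: "\<not> negligible S"
  proof -
    have "e \<noteq> {}" using H inner_hproj [OF n, of c 0] by auto
    then obtain y where "y \<in> rel_interior e"
      using face_compact_convex(2) [OF e] rel_interior_eq_empty by blast
    then obtain r where r: "r > 0" "ball y r \<inter> {x. n \<bullet> x = c} \<subseteq> e" and "y \<in> e"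
      using H by (auto simp: mem_rel_interior_ball)
    have "open (hproj n c -` ball y r)"
      by (intro open_vimage open_ball) (simp add: continuous_on_hproj)
    moreover have "hproj n c y = y" using hull_inc [OF \<open>y \<in> e\<close>, of affine] unfolding H by (intro hproj_same) simp
    then have "y \<in> hproj n c -` ball y r" using r by simp
    ultimately have "\<not> negligible (hproj n c -` ball y r)" using open_not_negligible by blast
    moreover have "hproj n c -` ball y r \<subseteq> S" using r inner_hproj [OF n] by (auto simp: S_def)
    ultimately show ?thesis using negligible_subset by blast
  qed
  have nu: "?\<nu> = 0"
  proof (rule ccontr)
    assume "?\<nu> \<noteq> 0"
    with neg S show False by (simp add: S_def)
  qed
  \<comment> \<open>The number \<open>?\<nu>\<close> is the derivative of the difference in the
    normal direction.\<close>
  have "affc \<alpha> \<beta> (hproj n c x) = affc \<alpha> \<beta> x - of_real (n \<bullet> x - c) * ?\<nu>" for x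
    by (simp add: affc_def hproj_def sum_distrib_left sum_subtractf sum.distrib algebra_simps)
  then have "affc \<alpha> \<beta> (hproj n c x) = affc \<alpha> \<beta> x" for x by (simp only: nu) simp
  then have "negligible {x\<in>S. piece w K\<^sub>1 x \<noteq> piece w K\<^sub>2 x}"
    using neg nu by (simp add: S_def flip: diff)
  then have "piece w K\<^sub>1 = piece w K\<^sub>2"
    using S K12 w by (intro P1c_eqI [of _ _ S] piece_P1c)
  moreover have "K \<in> {K\<^sub>1, K\<^sub>2}" "K' \<in> {K\<^sub>1, K\<^sub>2}" using K two by blast+
  ultimately show ?thesis by auto
qed

section \<open>Coordinates of discrete functions\<close>

text \<open>A degree of freedom is a triple of an element, a component (\<open>None\<close> for
  the scalar unknown, \<open>Some i\<close> for the \<open>i\<close>-th component of the flux) and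
  a monomial (\<open>None\<close> for the constant, \<open>Some j\<close> for the
  \<open>j\<close>-th coordinate).\<close>

definition coeff_piece ::
    "((real^'d) set \<times> 'd option \<times> 'd option \<Rightarrow> complex) \<Rightarrow> 'd option \<Rightarrow> (real^'d) set \<Rightarrow> real^'d \<Rightarrow> complex" where
  "coeff_piece c m K = affc (c (K, m, None)) (\<chi> j. c (K, m, Some j))"

definition coeff_u :: "((real^'d) set \<times> 'd option \<times> 'd option \<Rightarrow> complex) \<Rightarrow> real^'d \<Rightarrow> complex" where
  "coeff_u c = glue (coeff_piece c None)"

definition coeff_sigma ::
    "((real^'d) set \<times> 'd option \<times> 'd option \<Rightarrow> complex) \<Rightarrow> real^'d \<Rightarrow> complex^'d" where
  "coeff_sigma c x = (\<chi> i. glue (coeff_piece c (Some i)) x)"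

definition dofs :: "((real^'d) set \<times> 'd option \<times> 'd option) set" where
  "dofs = T \<times> UNIV"

lemma finite_dofs: "finite dofs"
  by (simp add: dofs_def finite_mesh)

lemma coeff_u_V_h: "coeff_u c \<in> V_h \<Omega> T"
  unfolding coeff_u_def coeff_piece_def by (intro glue_V_h affc_in_P1c)

lemma coeff_sigma_Sigma_h: "coeff_sigma c \<in> Sigma_h \<Omega> T"
  unfolding Sigma_h_def coeff_sigma_def coeff_piece_def by (simp add: glue_V_h affc_in_P1c)

lemma piece_coeff_u: "K \<in> T \<Longrightarrow> piece (coeff_u c) K = coeff_piece c None K"
  unfolding coeff_u_def coeff_piece_def by (simp add: piece_glue affc_in_P1c)

lemma piece_coeff_sigma: "K \<in> T \<Longrightarrow> piece (\<lambda>x. coeff_sigma c x $ i) K = coeff_piece c (Some i) K"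
  unfolding coeff_sigma_def coeff_piece_def by (simp add: piece_glue affc_in_P1c)

lemma coeff_piece_comb:
  "coeff_piece (\<lambda>j. c j + a * d j) m K x = coeff_piece c m K x + a * coeff_piece d m K x"
proof -
  have "(\<chi> j. c (K, m, Some j) + a * d (K, m, Some j)) =
      (\<chi> j. c (K, m, Some j)) + a *s (\<chi> j. d (K, m, Some j))"
    by (simp add: vec_eq_iff)
  then show ?thesis by (simp add: coeff_piece_def affc_comb)
qed

lemma coeff_u_comb: "coeff_u (\<lambda>j. c j + a * d j) = (\<lambda>x. coeff_u c x + a * coeff_u d x)"
  by (simp add: coeff_u_def glue_def coeff_piece_comb fun_eq_iff sum.distrib sum_distrib_left)

lemma coeff_sigma_comb:
  "coeff_sigma (\<lambda>j. c j + a * d j) = (\<lambda>x. coeff_sigma c x + a *s coeff_sigma d x)"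
  by (simp add: coeff_sigma_def glue_def coeff_piece_comb fun_eq_iff vec_eq_iff sum.distrib sum_distrib_left)

lemma coeff_zero:
  assumes "\<forall>j\<in>dofs. c j = 0"
  shows "coeff_u c = (\<lambda>x. 0)" "coeff_sigma c = (\<lambda>x. 0)"
proof -
  have "coeff_piece c m K x = 0" if "K \<in> T" for m K x
    using assms that by (simp add: coeff_piece_def affc_def dofs_def)
  then show "coeff_u c = (\<lambda>x. 0)" "coeff_sigma c = (\<lambda>x. 0)"
    by (auto simp: coeff_u_def coeff_sigma_def glue_def fun_eq_iff vec_eq_iff intro!: sum.neutral)
qed

lemma coeff_zeroD:
  assumes u: "AE x in lebesgue_on \<Omega>. coeff_u c x = 0" and \<sigma>: "AE x in lebesgue_on \<Omega>. coeff_sigma c x = 0"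
  shows "\<forall>j\<in>dofs. c j = 0"
proof
  fix j assume "j \<in> dofs"
  then obtain K m l where j: "j = (K, m, l)" and K: "K \<in> T" by (auto simp: dofs_def)
  have "coeff_piece c m K = (\<lambda>x. 0)"
  proof (cases m)
    case None
    then show ?thesis using null_pieces [OF u K] piece_coeff_u [OF K] by simp
  next
    case (Some i)
    have "AE x in lebesgue_on \<Omega>. coeff_sigma c x $ i = 0" using \<sigma> by eventually_elim simp
    then show ?thesis using null_pieces [OF _ K] piece_coeff_sigma [OF K] Some by metis
  qed
  then have "c (K, m, None) = 0" "(\<chi> j. c (K, m, Some j)) = 0"
    unfolding coeff_piece_def by (rule affc_eq_0D)+
  then show "c j = 0" by (cases l) (auto simp: j vec_eq_iff)
qed

text \<open>The coefficients of an affine function are read off from its values at the origin and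
  at the unit vectors.\<close>

lemma coeffs_exist:
  assumes v: "v \<in> V_h \<Omega> T" and \<tau>: "\<tau> \<in> Sigma_h \<Omega> T"
  obtains c where "AE x in lebesgue_on \<Omega>. v x = coeff_u c x" "AE x in lebesgue_on \<Omega>. \<tau> x = coeff_sigma c x"
proof -
  define p where "p m K = (case m of None \<Rightarrow> piece v K | Some i \<Rightarrow> piece (\<lambda>x. \<tau> x $ i) K)" for m K
  define c where "c = (\<lambda>(K, m, l). case l of None \<Rightarrow> p m K 0 | Some j \<Rightarrow> p m K (axis j 1) - p m K 0)"
  have c: "coeff_piece c m K = p m K" if K: "K \<in> T" for m K
  proof -
    have "p m K \<in> P1c"
      using piece_P1c [OF v K] piece_P1c [OF Sigma_h_component [OF \<tau>] K]
      by (simp add: p_def split: option.split)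
    then obtain \<alpha> \<beta> where ab: "p m K = affc \<alpha> \<beta>" by (auto simp: P1c_eq_affc)
    have "affc \<alpha> \<beta> 0 = \<alpha>" "affc \<alpha> \<beta> (axis j 1) = \<alpha> + \<beta> $ j" for j
      by (simp_all add: affc_def axis_def if_distrib cong: if_cong)
    then show ?thesis by (simp add: coeff_piece_def c_def ab)
  qed
  have "AE x in lebesgue_on \<Omega>. v x = coeff_u c x"
    by (intro V_h_AE_eqI v coeff_u_V_h) (simp add: piece_coeff_u c p_def)
  moreover have "AE x in lebesgue_on \<Omega>. \<tau> x $ i = coeff_sigma c x $ i" for i
    by (intro V_h_AE_eqI Sigma_h_component \<tau> coeff_sigma_Sigma_h) (simp add: piece_coeff_sigma c p_def)
  then have "AE x in lebesgue_on \<Omega>. \<forall>i. \<tau> x $ i = coeff_sigma c x $ i"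
    by (intro AE_all_countable [THEN iffD2] allI)
  then have "AE x in lebesgue_on \<Omega>. \<tau> x = coeff_sigma c x" by (simp add: vec_eq_iff)
  ultimately show thesis by (rule that)
qed

end

section \<open>Uniqueness\<close>

locale ldg = mesh \<Omega> T for \<Omega> :: "(real^'d) set" and T +
  fixes k \<beta> \<delta> :: real
  assumes k_pos: "k > 0" and beta_pos: "\<beta> > 0" and delta_pos: "\<delta> > 0"
begin

abbreviation "B \<equiv> B_h \<Omega> T k \<beta> \<delta>"

text \<open>With \<open>a\<close> and \<open>p e\<close> for the mixed terms, the imaginary parts
  of the equations for the test functions \<open>(w, 0)\<close> and \<open>(0, \<zeta>)\<close>
  contain \<open>Im a\<close> and \<open>Im (p e)\<close> in the same way, because each mixed term
  occurs in the second equation as the negative of the conjugate. They cancel in the difference,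
  which leaves only nonnegative terms.\<close>

lemma kernel_traces_vanish:
  assumes w: "w \<in> V_h \<Omega> T" and \<zeta>: "\<zeta> \<in> Sigma_h \<Omega> T"
    and ker: "\<And>v \<tau>. v \<in> V_h \<Omega> T \<Longrightarrow> \<tau> \<in> Sigma_h \<Omega> T \<Longrightarrow> B w \<zeta> v \<tau> = 0"
  shows "AE x in surface_measure (frontier \<Omega>). boundary_trace T w x = 0"
    and "e \<in> interior_faces T \<Longrightarrow> AE x in surface_measure e. jump T w e x = 0"
    and "e \<in> interior_faces T \<Longrightarrow> AE x in surface_measure e. vjump T \<zeta> e x = 0"
proof -
  define a where "a = vip (lebesgue_on \<Omega>) \<zeta> (broken_grad T w)"
  define G where "G = Re (ip (surface_measure (frontier \<Omega>)) (boundary_trace T w) (boundary_trace T w))"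
  define J where "J e = Re (vip (surface_measure e) (jump T w e) (jump T w e))" for e
  define D where "D e = Re (ip (surface_measure e) (vjump T \<zeta> e) (vjump T \<zeta> e))" for e
  define p where "p e = vip (surface_measure e) (vavg T \<zeta> e) (jump T w e)" for e
  have real: "ip (surface_measure (frontier \<Omega>)) (boundary_trace T w) (boundary_trace T w) = of_real G"
    "vip (surface_measure e) (jump T w e) (jump T w e) = of_real (J e)"
    "ip (surface_measure e) (vjump T \<zeta> e) (vjump T \<zeta> e) = of_real (D e)"
    "Im (ip (lebesgue_on \<Omega>) w w) = 0" for e
    by (simp_all add: G_def J_def D_def ip_self vip_self_real complex_eq_iff)
  have conj: "vip (lebesgue_on \<Omega>) (broken_grad T w) \<zeta> = cnj a"
    "vip (surface_measure e) (jump T w e) (vavg T \<zeta> e) = cnj (p e)" for e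
    unfolding a_def p_def by (rule vip_commute)+
  have "B w \<zeta> w (\<lambda>x. 0) = 0" using ker w zero_Sigma_h by blast
  then have "Im (a - (of_real k)\<^sup>2 * ip (lebesgue_on \<Omega>) w w + \<i> * of_real k * of_real G
      + (\<Sum>e\<in>interior_faces T. \<i> * of_real \<beta> * of_real (J e) - p e)) = 0"
    by (simp add: B_h_eq w \<zeta> zero_Sigma_h null_vtraces face_form_def ip_AE_0 vip_AE_0 real a_def p_def)
  then have 1: "Im a + k * G + (\<Sum>e\<in>interior_faces T. \<beta> * J e - Im (p e)) = 0"
    using real(4) by (simp add: Im_sum power2_eq_square)
  have "B w \<zeta> (\<lambda>x. 0) \<zeta> = 0" using ker \<zeta> zero_V_h by blast
  then have "Im ((\<Sum>e\<in>interior_faces T. cnj (p e) - \<i> * of_real \<delta> * of_real (D e))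
      + vip (lebesgue_on \<Omega>) \<zeta> \<zeta> - cnj a) = 0"
    by (simp add: B_h_eq w \<zeta> zero_V_h null_traces face_form_def ip_AE_0 vip_AE_0 real conj)
  then have 2: "(\<Sum>e\<in>interior_faces T. - Im (p e) - \<delta> * D e) + Im a = 0"
    by (simp add: Im_sum vip_self_real)
  have sum0: "k * G + (\<Sum>e\<in>interior_faces T. \<beta> * J e + \<delta> * D e) = 0"
    using 1 2 by (simp add: sum.distrib sum_subtractf sum_negf)
  have nonneg: "G \<ge> 0" "J e \<ge> 0" "D e \<ge> 0" for e
    unfolding G_def J_def D_def by (rule ip_self_nonneg vip_self_nonneg)+
  have terms: "\<beta> * J e + \<delta> * D e \<ge> 0" for e
    using nonneg beta_pos delta_pos by (intro add_nonneg_nonneg mult_nonneg_nonneg) auto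
  have "k * G \<ge> 0" using nonneg k_pos by simp
  then have "k * G = 0" and zero: "(\<Sum>e\<in>interior_faces T. \<beta> * J e + \<delta> * D e) = 0"
    using sum0 sum_nonneg [of "interior_faces T" "\<lambda>e. \<beta> * J e + \<delta> * D e"] terms by (smt (verit))+
  then have "G = 0" using k_pos by simp
  then show "AE x in surface_measure (frontier \<Omega>). boundary_trace T w x = 0"
    using boundary_trace_L2 [OF w] by (intro ip_self_0) (auto simp: G_def)
  assume e: "e \<in> interior_faces T"
  have "\<beta> * J e + \<delta> * D e = 0"
    using zero terms finite_interior_faces e by (simp add: sum_nonneg_eq_0_iff)
  moreover have "\<beta> * J e \<ge> 0" "\<delta> * D e \<ge> 0"
    using nonneg beta_pos delta_pos by auto
  ultimately have "\<beta> * J e = 0" "\<delta> * D e = 0" by linarith+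
  then have "J e = 0" "D e = 0" using beta_pos delta_pos by auto
  then show "AE x in surface_measure e. jump T w e x = 0" "AE x in surface_measure e. vjump T \<zeta> e x = 0"
    using jump_L2 [OF e w] vjump_L2 [OF e \<zeta>]
    by (auto intro!: vip_self_0 ip_self_0 simp: J_def D_def)
qed

text \<open>With the jumps gone, testing with \<open>(0, \<tau>)\<close> says that
  \<open>\<zeta>\<close> minus the piecewise gradient is orthogonal to every
  \<open>\<tau>\<close>. The difference itself is admissible as \<open>\<tau>\<close> since the
  piecewise gradient of a piecewise affine function is piecewise constant.\<close>

lemma kernel_flux:
  assumes w: "w \<in> V_h \<Omega> T" and \<zeta>: "\<zeta> \<in> Sigma_h \<Omega> T"
    and ker: "\<And>v \<tau>. v \<in> V_h \<Omega> T \<Longrightarrow> \<tau> \<in> Sigma_h \<Omega> T \<Longrightarrow> B w \<zeta> v \<tau> = 0"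
  shows "AE x in lebesgue_on \<Omega>. \<zeta> x = broken_grad T w x"
proof -
  define \<tau> where "\<tau> = (\<lambda>x. \<zeta> x + (- 1) *s broken_grad T w x)"
  have \<tau>: "\<tau> \<in> Sigma_h \<Omega> T" unfolding \<tau>_def by (intro Sigma_h_comb \<zeta> broken_grad_Sigma_h w)
  have "face_form \<beta> \<delta> e w \<zeta> (\<lambda>x. 0) \<tau> = 0" if "e \<in> interior_faces T" for e
    using kernel_traces_vanish(2,3) [OF w \<zeta> ker that]
    by (simp add: face_form_def null_traces ip_AE_0 vip_AE_0)
  moreover have "B w \<zeta> (\<lambda>x. 0) \<tau> = 0" using ker \<tau> zero_V_h by blast
  ultimately have "vip (lebesgue_on \<Omega>) \<zeta> \<tau> - vip (lebesgue_on \<Omega>) (broken_grad T w) \<tau> = 0"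
    by (simp add: B_h_eq w \<zeta> \<tau> zero_V_h null_traces ip_AE_0 vip_AE_0)
  moreover have "vip (lebesgue_on \<Omega>) \<tau> \<tau> =
      vip (lebesgue_on \<Omega>) \<zeta> \<tau> + (- 1) * vip (lebesgue_on \<Omega>) (broken_grad T w) \<tau>"
    using vip_comb_left [OF Sigma_h_L2v [OF \<zeta>] Sigma_h_L2v [OF broken_grad_Sigma_h [OF w]]
        Sigma_h_L2v [OF \<tau>], of "- 1", folded \<tau>_def] .
  ultimately have "vip (lebesgue_on \<Omega>) \<tau> \<tau> = 0" by simp
  then have "AE x in lebesgue_on \<Omega>. \<tau> x = 0"
    using Sigma_h_L2v [OF \<tau>] by (intro vip_self_0) auto
  then show ?thesis by eventually_elim (simp add: \<tau>_def)
qed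

lemma kernel_trivial:
  assumes w: "w \<in> V_h \<Omega> T" and \<zeta>: "\<zeta> \<in> Sigma_h \<Omega> T"
    and ker: "\<And>v \<tau>. v \<in> V_h \<Omega> T \<Longrightarrow> \<tau> \<in> Sigma_h \<Omega> T \<Longrightarrow> B w \<zeta> v \<tau> = 0"
  shows "AE x in lebesgue_on \<Omega>. w x = 0 \<and> \<zeta> x = 0"
proof -
  have flux: "AE x in lebesgue_on \<Omega>. \<zeta> x = broken_grad T w x" by (rule kernel_flux [OF assms])
  have grad: "vpiece \<zeta> K x = grad (piece w K) x" if "K \<in> T" for K x
  proof -
    have "piece (\<lambda>y. \<zeta> y $ i) K = piece (\<lambda>y. broken_grad T w y $ i) K" for i
    proof (rule piece_cong [OF _ that])
      show "AE x in lebesgue_on \<Omega>. \<zeta> x $ i = broken_grad T w x $ i"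
        using flux by eventually_elim simp
    qed
    then have "vpiece \<zeta> K x = vpiece (broken_grad T w) K x" by (simp add: vpiece_def)
    then show ?thesis using vpiece_broken_grad [OF w that] by simp
  qed
  have zero: "piece w K = (\<lambda>x. 0)" if K: "K \<in> T" for K
  proof (rule matching_pieces_vanish [OF _ _ _ K])
    show "piece w K' \<in> P1c" if "K' \<in> T" for K' using piece_P1c [OF w that] .
    show "piece w K' = piece w K''"
      if "K' \<in> T" "K'' \<in> T" "K' \<noteq> K''" "aff_dim (K' \<inter> K'') = int DIM(real^'d) - 1" for K' K''
    proof -
      have e: "K' \<inter> K'' \<in> interior_faces T" using that unfolding interior_faces_def by blast
      show ?thesis
        using pieces_agree_across_face [OF e w grad kernel_traces_vanish(2,3) [OF w \<zeta> ker e]] that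
        by blast
    qed
    show "AE x in surface_measure (frontier \<Omega>). (\<Sum>K\<in>{K\<in>T. x \<in> K}. piece w K x) = 0"
      using kernel_traces_vanish(1) [OF w \<zeta> ker] by (simp add: boundary_trace_def)
  qed
  have "AE x in lebesgue_on \<Omega>. w x = 0"
    using zero null_pieces [of "\<lambda>x. 0"] by (intro V_h_AE_eqI w zero_V_h) auto
  with flux show ?thesis by eventually_elim (simp add: null_traces [OF \<open>AE x in lebesgue_on \<Omega>. w x = 0\<close>])
qed

lemma solution_unique:
  assumes "LDG_solution \<Omega> T k \<beta> \<delta> f g u \<sigma>" "LDG_solution \<Omega> T k \<beta> \<delta> f g u' \<sigma>'"
  shows "AE x in lebesgue_on \<Omega>. u' x = u x \<and> \<sigma>' x = \<sigma> x"
proof -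
  have mem: "u \<in> V_h \<Omega> T" "\<sigma> \<in> Sigma_h \<Omega> T" "u' \<in> V_h \<Omega> T" "\<sigma>' \<in> Sigma_h \<Omega> T"
    using assms by (auto simp: LDG_solution_def)
  have "AE x in lebesgue_on \<Omega>. u' x + (- 1) * u x = 0 \<and> \<sigma>' x + (- 1) *s \<sigma> x = 0"
  proof (rule kernel_trivial)
    fix v \<tau> assume v\<tau>: "v \<in> V_h \<Omega> T" "\<tau> \<in> Sigma_h \<Omega> T"
    then have "B u \<sigma> v \<tau> = B u' \<sigma>' v \<tau>" using assms by (simp add: LDG_solution_def)
    then show "B (\<lambda>x. u' x + (- 1) * u x) (\<lambda>x. \<sigma>' x + (- 1) *s \<sigma> x) v \<tau> = 0"
      using B_h_comb_left [OF mem(3,4,1,2) v\<tau>, of k \<beta> \<delta> "- 1"] by simp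
  qed (intro V_h_comb Sigma_h_comb mem)+
  then show ?thesis by eventually_elim simp
qed

section \<open>Existence\<close>

lemma B_h_test_AE_cong:
  assumes "w \<in> V_h \<Omega> T" "\<zeta> \<in> Sigma_h \<Omega> T" "v \<in> V_h \<Omega> T" "\<tau> \<in> Sigma_h \<Omega> T" "v' \<in> V_h \<Omega> T" "\<tau>' \<in> Sigma_h \<Omega> T"
    and v: "AE x in lebesgue_on \<Omega>. v x = v' x" and \<tau>: "AE x in lebesgue_on \<Omega>. \<tau> x = \<tau>' x"
  shows "B w \<zeta> v \<tau> = B w \<zeta> v' \<tau>'"
proof -
  have "B w \<zeta> (\<lambda>x. v x + (- 1) * v' x) (\<lambda>x. \<tau> x + (- 1) *s \<tau>' x) = 0"
  proof (rule B_h_null_right)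
    show "AE x in lebesgue_on \<Omega>. v x + (- 1) * v' x = 0" using v by eventually_elim simp
    show "AE x in lebesgue_on \<Omega>. \<tau> x + (- 1) *s \<tau>' x = 0" using \<tau> by eventually_elim simp
  qed (intro V_h_comb Sigma_h_comb assms)+
  then show ?thesis using B_h_comb_right [OF assms(1-6), of k \<beta> \<delta> "- 1"] by simp
qed

text \<open>The coordinate functions represent all discrete functions only up to null functions,
  so the equations for general test functions follow from invariance of both sides under changes
  on null sets.\<close>

lemma solution_exists:
  assumes f: "f \<in> L2 (lebesgue_on \<Omega>)" and g: "g \<in> L2 (surface_measure (frontier \<Omega>))"
  shows "\<exists>u \<sigma>. LDG_solution \<Omega> T k \<beta> \<delta> f g u \<sigma>"
proof -
  define F where "F v = ip (lebesgue_on \<Omega>) f v +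
    ip (surface_measure (frontier \<Omega>)) g (boundary_trace T v)" for v
  have F_comb: "F (\<lambda>x. v x + a * v' x) = F v + cnj a * F v'"
    if "v \<in> V_h \<Omega> T" "v' \<in> V_h \<Omega> T" for v v' a
    using that f g
    by (simp add: F_def boundary_trace_comb ip_comb_right V_h_L2 boundary_trace_L2 algebra_simps)
  have F_null: "F v = 0" if "AE x in lebesgue_on \<Omega>. v x = 0" for v
    using that by (simp add: F_def null_traces ip_AE_0)
  have F_cong: "F v = F v'" if "v \<in> V_h \<Omega> T" "v' \<in> V_h \<Omega> T" "AE x in lebesgue_on \<Omega>. v x = v' x" for v v'
  proof -
    have "AE x in lebesgue_on \<Omega>. v x + (- 1) * v' x = 0" using that(3) by eventually_elim simp
    then show ?thesis using F_null F_comb [OF that(1,2), of "- 1"] by simp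
  qed
  note mem = coeff_u_V_h coeff_sigma_Sigma_h
  have "\<exists>c. \<forall>d. B (coeff_u c) (coeff_sigma c) (coeff_u d) (coeff_sigma d) = F (coeff_u d)"
  proof (rule finite_dim_galerkin_solvable [OF finite_dofs])
    fix c c' d :: "(real^'d) set \<times> 'd option \<times> 'd option \<Rightarrow> complex" and a
    show "B (coeff_u (\<lambda>j. c j + a * c' j)) (coeff_sigma (\<lambda>j. c j + a * c' j)) (coeff_u d) (coeff_sigma d) =
      B (coeff_u c) (coeff_sigma c) (coeff_u d) (coeff_sigma d) +
      a * B (coeff_u c') (coeff_sigma c') (coeff_u d) (coeff_sigma d)"
      unfolding coeff_u_comb coeff_sigma_comb by (intro B_h_comb_left mem)
    show "B (coeff_u d) (coeff_sigma d) (coeff_u (\<lambda>j. c j + a * c' j)) (coeff_sigma (\<lambda>j. c j + a * c' j)) =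
      B (coeff_u d) (coeff_sigma d) (coeff_u c) (coeff_sigma c) +
      cnj a * B (coeff_u d) (coeff_sigma d) (coeff_u c') (coeff_sigma c')"
      unfolding coeff_u_comb coeff_sigma_comb by (intro B_h_comb_right mem)
    show "F (coeff_u (\<lambda>j. c j + a * c' j)) = F (coeff_u c) + cnj a * F (coeff_u c')"
      unfolding coeff_u_comb by (intro F_comb mem)
  next
    fix c d :: "(real^'d) set \<times> 'd option \<times> 'd option \<Rightarrow> complex"
    assume c: "\<forall>j\<in>dofs. c j = 0"
    show "B (coeff_u d) (coeff_sigma d) (coeff_u c) (coeff_sigma c) = 0"
      using coeff_zero [OF c] by (intro B_h_null_right mem) simp_all
    show "B (coeff_u c) (coeff_sigma c) (coeff_u d) (coeff_sigma d) = 0"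
      using B_h_comb_left [OF zero_V_h zero_Sigma_h zero_V_h zero_Sigma_h mem [of d], of k \<beta> \<delta> "- 1"]
      by (simp add: coeff_zero [OF c])
    show "F (coeff_u c) = 0" using coeff_zero [OF c] by (intro F_null) simp
  next
    fix c :: "(real^'d) set \<times> 'd option \<times> 'd option \<Rightarrow> complex"
    assume c: "\<forall>d. B (coeff_u c) (coeff_sigma c) (coeff_u d) (coeff_sigma d) = 0"
    have "AE x in lebesgue_on \<Omega>. coeff_u c x = 0 \<and> coeff_sigma c x = 0"
    proof (rule kernel_trivial [OF mem])
      fix v \<tau> assume v\<tau>: "v \<in> V_h \<Omega> T" "\<tau> \<in> Sigma_h \<Omega> T"
      obtain d where "AE x in lebesgue_on \<Omega>. v x = coeff_u d x" "AE x in lebesgue_on \<Omega>. \<tau> x = coeff_sigma d x"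
        by (rule coeffs_exist [OF v\<tau>])
      then have "B (coeff_u c) (coeff_sigma c) v \<tau> = B (coeff_u c) (coeff_sigma c) (coeff_u d) (coeff_sigma d)"
        by (intro B_h_test_AE_cong mem v\<tau>)
      with c show "B (coeff_u c) (coeff_sigma c) v \<tau> = 0" by simp
    qed
    then show "\<forall>j\<in>dofs. c j = 0" by (intro coeff_zeroD) (auto elim: eventually_mono)
  qed
  then obtain c where c: "\<And>d. B (coeff_u c) (coeff_sigma c) (coeff_u d) (coeff_sigma d) = F (coeff_u d)"
    by blast
  have "B (coeff_u c) (coeff_sigma c) v \<tau> = F v" if v\<tau>: "v \<in> V_h \<Omega> T" "\<tau> \<in> Sigma_h \<Omega> T" for v \<tau>
  proof -
    obtain d where d: "AE x in lebesgue_on \<Omega>. v x = coeff_u d x" "AE x in lebesgue_on \<Omega>. \<tau> x = coeff_sigma d x"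
      by (rule coeffs_exist [OF v\<tau>])
    have "B (coeff_u c) (coeff_sigma c) v \<tau> = B (coeff_u c) (coeff_sigma c) (coeff_u d) (coeff_sigma d)"
      by (intro B_h_test_AE_cong mem v\<tau> d)
    also have "\<dots> = F v" using c F_cong [OF v\<tau>(1) mem(1) d(1)] by simp
    finally show ?thesis .
  qed
  then have "LDG_solution \<Omega> T k \<beta> \<delta> f g (coeff_u c) (coeff_sigma c)"
    using mem by (simp add: LDG_solution_def F_def)
  then show ?thesis by blast
qed

end

theorem theorem3p4:
  fixes \<Omega> :: "(real^'d) set" and x\<^sub>\<Omega> :: "real^'d"
    and I :: "real set" and T :: "real \<Rightarrow> (real^'d) set set"
    and f g :: "real^'d \<Rightarrow> complex" and k h \<delta> \<beta> :: real
  assumes "CARD('d) = 2 \<or> CARD('d) = 3"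
    and "open \<Omega>" and "connected \<Omega>" and "\<Omega> \<noteq> {}" and "bounded \<Omega>"
    and "x\<^sub>\<Omega> \<in> \<Omega>" and "strictly_star_shaped \<Omega> x\<^sub>\<Omega>"
    and "mesh_family \<Omega> I T" and "h \<in> I"
    and "f \<in> L2 (lebesgue_on \<Omega>)" and "g \<in> L2 (surface_measure (frontier \<Omega>))"
    and "k > 0" and "h > 0" and "\<delta> > 0" and "\<beta> > 0"
  shows "\<exists>u \<sigma>. LDG_solution \<Omega> (T h) k \<beta> \<delta> f g u \<sigma> \<and>
    (\<forall>u' \<sigma>'. LDG_solution \<Omega> (T h) k \<beta> \<delta> f g u' \<sigma>' \<longrightarrow>
       (AE x in lebesgue_on \<Omega>. u' x = u x \<and> \<sigma>' x = \<sigma> x))"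
proof -
  interpret ldg \<Omega> "T h" k \<beta> \<delta>
    using assms by unfold_locales (auto simp: mesh_family_def)
  show ?thesis using solution_exists solution_unique assms by blast
qed

end
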